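(* Let $\varphi \in L^\infty$. Then $T_\varphi \in \mathcal{AN}(H^2)$ if and only if $|\varphi| = \|\varphi\|_\infty$ $\mu$-almost everywhere and $(I-P)\varphi$ is a rational function.
   Context: Let $\mathbb{T}$ be the unit circle in $\mathbb{C}$ with normalized Lebesgue measure $\mu$. $L^2$ is the Hilbert space of complex-valued square integrable functions on $\mathbb{T}$ with respect to $\mu$, and $L^\infty$ is the Banach space of complex-valued essentially bounded $\mu$-measurable functions on $\mathbb{T}$, with norm $\|\cdot\|_\infty$. $H^2$ is the closed subspace of $L^2$ of all functions whose negative Fourier coefficients vanish, $P$ is the orthogonal projection of $L^2$ onto $H^2$, and $I$ is the identity operator. For $\varphi \in L^\infty$ the Toeplitz operator $T_\varphi : H^2 \to H^2$ is $T_\varphi f = P(\varphi f)$, where $(\varphi f)(z) = \varphi(z) f(z)$. Here $\varphi \in L^\infty \subset L^2$ and $(I-P)\varphi \in L^2$; "rational function" means that it coincides $\mu$-a.e. on $\mathbb{T}$ with a rational function of $z$. A bounded linear operator $T : H_1 \to H_2$ between Hilbert spaces is norm attaining if there is a unit vector $x \in H_1$ with $\|Tx\| = \|T\|$. It is absolutely norm attaining (an $\mathcal{AN}$-operator) if for every nonzero closed subspace $M$ of $H_1$ the restriction $T|_M : M \to H_2$ is norm attaining. $\mathcal{AN}(H^2)$ denotes the set of all $\mathcal{AN}$-operators from $H^2$ to $H^2$. *)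

theory Defs
  imports
    "HOL-Probability.Probability"
    "HOL-Computational_Algebra.Polynomial"
begin

text \<open>The image of the uniform distribution on \<open>[0, 2\<pi>)\<close> under \<open>t \<mapsto> e\<^sup>i\<^sup>t\<close>, completed so that
  measurability means Lebesgue (and not only Borel) measurability. The space of this measure is the
  unit circle, so values of functions off the circle are irrelevant.\<close>

definition circle :: "complex measure" where
  "circle = completion (distr (uniform_measure lborel {0..<2 * pi})
                              (restrict_space borel (sphere 0 1)) cis)"

lemma measurable_cis: "cis \<in> borel \<rightarrow>\<^sub>M restrict_space borel (sphere 0 1)"
  by (intro measurable_restrict_space2 borel_measurable_continuous_onI continuous_intros) auto

lemma space_circle: "space circle = sphere 0 1"
  by (simp add: circle_def space_restrict_space)

lemma prob_space_circle: "prob_space circle"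
proof -
  have "prob_space (uniform_measure lborel {0..<2 * pi})"
    by (rule prob_space_uniform_measure) auto
  then have "prob_space (distr (uniform_measure lborel {0..<2 * pi})
                               (restrict_space borel (sphere 0 1)) cis)"
    by (rule prob_space.prob_space_distr) (use measurable_cis in \<open>simp cong: measurable_cong_sets\<close>)
  then show ?thesis
    unfolding circle_def by (rule prob_space.prob_space_completion)
qed

definition square_integrable :: "(complex \<Rightarrow> complex) set" where
  "square_integrable =
     {f \<in> borel_measurable circle. integrable circle (\<lambda>z. (cmod (f z))\<^sup>2)}"

lemma square_integrableD:
  assumes "f \<in> square_integrable"
  shows "f \<in> borel_measurable circle" "integrable circle (\<lambda>z. (cmod (f z))\<^sup>2)"
  using assms by (auto simp: square_integrable_def)

lemma zero_square_integrable: "(\<lambda>_. 0) \<in> square_integrable"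
  by (simp add: square_integrable_def)

lemma scale_square_integrable:
  assumes "f \<in> square_integrable"
  shows "(\<lambda>z. c * f z) \<in> square_integrable"
  using assms by (auto simp: square_integrable_def norm_mult power_mult_distrib)

lemma add_square_integrable:
  assumes "f \<in> square_integrable" "g \<in> square_integrable"
  shows "(\<lambda>z. f z + g z) \<in> square_integrable"
proof -
  note [measurable] = square_integrableD(1)[OF assms(1)] square_integrableD(1)[OF assms(2)]
  have "integrable circle (\<lambda>z. 2 * (cmod (f z))\<^sup>2 + 2 * (cmod (g z))\<^sup>2)"
    by (intro Bochner_Integration.integrable_add integrable_mult_right square_integrableD assms)
  then have "integrable circle (\<lambda>z. (cmod (f z + g z))\<^sup>2)"
  proof (rule Bochner_Integration.integrable_bound)
    show "AE z in circle. norm ((cmod (f z + g z))\<^sup>2)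
            \<le> norm (2 * (cmod (f z))\<^sup>2 + 2 * (cmod (g z))\<^sup>2)"
    proof (rule AE_I2)
      fix z
      have "(cmod (f z + g z))\<^sup>2 \<le> (cmod (f z) + cmod (g z))\<^sup>2"
        by (intro power_mono norm_triangle_ineq) auto
      also have "\<dots> \<le> 2 * (cmod (f z))\<^sup>2 + 2 * (cmod (g z))\<^sup>2"
        using sum_squares_bound[of "cmod (f z)" "cmod (g z)"] by (simp add: power2_sum)
      finally show "norm ((cmod (f z + g z))\<^sup>2)
            \<le> norm (2 * (cmod (f z))\<^sup>2 + 2 * (cmod (g z))\<^sup>2)"
        by simp
    qed
  qed measurable
  then show ?thesis
    by (simp add: square_integrable_def)
qed

lemma borel_measurable_cnj [measurable]: "cnj \<in> borel_measurable borel"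
  by (intro borel_measurable_continuous_onI continuous_intros)

lemma integrable_product:
  assumes "f \<in> square_integrable" "g \<in> square_integrable"
  shows "integrable circle (\<lambda>z. f z * cnj (g z))"
proof -
  note [measurable] = square_integrableD(1)[OF assms(1)] square_integrableD(1)[OF assms(2)]
  have "integrable circle (\<lambda>z. (cmod (f z))\<^sup>2 + (cmod (g z))\<^sup>2)"
    by (intro Bochner_Integration.integrable_add square_integrableD assms)
  then show ?thesis
  proof (rule Bochner_Integration.integrable_bound)
    show "AE z in circle. norm (f z * cnj (g z)) \<le> norm ((cmod (f z))\<^sup>2 + (cmod (g z))\<^sup>2)"
    proof (rule AE_I2)
      fix z
      have "cmod (f z) * cmod (g z) \<le> 2 * cmod (f z) * cmod (g z)"
        by simp
      also have "\<dots> \<le> (cmod (f z))\<^sup>2 + (cmod (g z))\<^sup>2"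
        by (rule sum_squares_bound)
      finally show "norm (f z * cnj (g z)) \<le> norm ((cmod (f z))\<^sup>2 + (cmod (g z))\<^sup>2)"
        by (simp add: norm_mult)
    qed
  qed measurable
qed

definition eq_AE :: "(complex \<Rightarrow> complex) \<Rightarrow> (complex \<Rightarrow> complex) \<Rightarrow> bool" where
  "eq_AE f g \<longleftrightarrow>
     f \<in> square_integrable \<and> g \<in> square_integrable \<and> (AE z in circle. f z = g z)"

quotient_type L2 = "complex \<Rightarrow> complex" / partial: eq_AE
proof (rule part_equivpI)
  show "\<exists>f. eq_AE f f"
    using zero_square_integrable by (auto simp: eq_AE_def)
  show "symp eq_AE"
    by (auto simp: eq_AE_def symp_def elim: AE_mp)
  show "transp eq_AE"
    unfolding transp_def eq_AE_def by (auto elim: AE_mp)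
qed

lift_definition cinner :: "L2 \<Rightarrow> L2 \<Rightarrow> complex" is
  "\<lambda>f g. \<integral>z. f z * cnj (g z) \<partial>circle"
proof -
  fix f f' g g' assume "eq_AE f f'" "eq_AE g g'"
  then have *: "AE z in circle. f z = f' z" "AE z in circle. g z = g' z"
    and [measurable]: "f \<in> borel_measurable circle" "f' \<in> borel_measurable circle"
      "g \<in> borel_measurable circle" "g' \<in> borel_measurable circle"
    by (auto simp: eq_AE_def square_integrable_def)
  show "(\<integral>z. f z * cnj (g z) \<partial>circle) = (\<integral>z. f' z * cnj (g' z) \<partial>circle)"
    by (rule integral_cong_AE) (use * in auto)
qed

lift_definition scaleC :: "complex \<Rightarrow> L2 \<Rightarrow> L2" is "\<lambda>c f z. c * f z"
  by (auto simp: eq_AE_def scale_square_integrable)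

text \<open>The real vector space structure and the real inner product \<open>Re \<langle>f, g\<rangle>\<close>; they induce the
  usual norm and metric of \<open>L\<^sup>2\<close>, since \<open>\<langle>f, f\<rangle>\<close> is real.\<close>

instantiation L2 :: real_inner
begin

lift_definition zero_L2 :: L2 is "\<lambda>_. 0"
  by (simp add: eq_AE_def zero_square_integrable)

lift_definition plus_L2 :: "L2 \<Rightarrow> L2 \<Rightarrow> L2" is "\<lambda>f g z. f z + g z"
  by (auto simp: eq_AE_def intro: add_square_integrable)

definition uminus_L2 :: "L2 \<Rightarrow> L2" where "uminus_L2 f = scaleC (-1) f"

definition minus_L2 :: "L2 \<Rightarrow> L2 \<Rightarrow> L2" where "minus_L2 f g = f + (- g)"

definition scaleR_L2 :: "real \<Rightarrow> L2 \<Rightarrow> L2" where "scaleR_L2 r f = scaleC (complex_of_real r) f"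

definition inner_L2 :: "L2 \<Rightarrow> L2 \<Rightarrow> real" where "inner_L2 f g = Re (cinner f g)"

definition norm_L2 :: "L2 \<Rightarrow> real" where "norm_L2 f = sqrt (inner f f)"

definition sgn_L2 :: "L2 \<Rightarrow> L2" where "sgn_L2 f = inverse (norm f) *\<^sub>R f"

definition dist_L2 :: "L2 \<Rightarrow> L2 \<Rightarrow> real" where "dist_L2 f g = norm (f - g)"

definition uniformity_L2 :: "(L2 \<times> L2) filter" where
  "uniformity_L2 = (INF e\<in>{0 <..}. principal {(x, y). dist x y < e})"

definition open_L2 :: "L2 set \<Rightarrow> bool" where
  "open_L2 U \<longleftrightarrow> (\<forall>x\<in>U. \<forall>\<^sub>F (x', y) in uniformity. x' = x \<longrightarrow> y \<in> U)"

instance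
proof
  fix a b c :: L2 and r s :: real
  show "a + b + c = a + (b + c)"
    by transfer (auto simp: eq_AE_def add.assoc intro!: add_square_integrable)
  show "a + b = b + a"
    by transfer (auto simp: eq_AE_def add.commute intro!: add_square_integrable)
  show "0 + a = a"
    by transfer (auto simp: eq_AE_def)
  show "- a + a = 0"
    unfolding uminus_L2_def
    by transfer (auto simp: eq_AE_def zero_square_integrable)
  show "a - b = a + - b"
    by (rule minus_L2_def)
  show "r *\<^sub>R (a + b) = r *\<^sub>R a + r *\<^sub>R b"
    unfolding scaleR_L2_def
    by transfer (auto simp: eq_AE_def ring_distribs
        intro!: add_square_integrable scale_square_integrable)
  show "(r + s) *\<^sub>R a = r *\<^sub>R a + s *\<^sub>R a"
    unfolding scaleR_L2_def
    by transfer (auto simp: eq_AE_def ring_distribs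
        intro!: add_square_integrable scale_square_integrable)
  show "r *\<^sub>R s *\<^sub>R a = (r * s) *\<^sub>R a"
    unfolding scaleR_L2_def
    by transfer (auto simp: eq_AE_def mult.assoc intro!: scale_square_integrable)
  show "1 *\<^sub>R a = a"
    unfolding scaleR_L2_def by transfer (auto simp: eq_AE_def)
  show "dist a b = norm (a - b)"
    by (rule dist_L2_def)
  show "sgn a = inverse (norm a) *\<^sub>R a"
    by (rule sgn_L2_def)
  show "inner a b = inner b a"
    unfolding inner_L2_def
  proof transfer
    fix f g assume "eq_AE f f" "eq_AE g g"
    have "(\<integral>z. g z * cnj (f z) \<partial>circle) = (\<integral>z. cnj (f z * cnj (g z)) \<partial>circle)"
      by (simp add: mult.commute)
    also have "\<dots> = cnj (\<integral>z. f z * cnj (g z) \<partial>circle)"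
      by (rule Bochner_Integration.integral_cnj)
    finally show "Re (\<integral>z. f z * cnj (g z) \<partial>circle) = Re (\<integral>z. g z * cnj (f z) \<partial>circle)"
      by simp
  qed
  show "inner (a + b) c = inner a c + inner b c"
    unfolding inner_L2_def
    by transfer (auto simp: eq_AE_def integrable_product ring_distribs)
  show "inner (r *\<^sub>R a) b = r * inner a b"
    unfolding inner_L2_def scaleR_L2_def
    by transfer (auto simp: eq_AE_def integrable_product mult.assoc)
  have inner_self: "Re (\<integral>z. f z * cnj (f z) \<partial>circle) = (\<integral>z. (cmod (f z))\<^sup>2 \<partial>circle)" for f
  proof -
    have "(\<integral>z. f z * cnj (f z) \<partial>circle) = (\<integral>z. complex_of_real ((cmod (f z))\<^sup>2) \<partial>circle)"
      by (simp only: complex_norm_square)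
    also have "\<dots> = complex_of_real (\<integral>z. (cmod (f z))\<^sup>2 \<partial>circle)"
      by (rule integral_complex_of_real)
    finally show ?thesis by simp
  qed
  show "0 \<le> inner a a"
    unfolding inner_L2_def by transfer (simp add: inner_self)
  show "inner a a = 0 \<longleftrightarrow> a = 0"
    unfolding inner_L2_def
  proof transfer
    fix f assume "eq_AE f f"
    then have f: "f \<in> square_integrable" by (simp add: eq_AE_def)
    then have "(\<integral>z. (cmod (f z))\<^sup>2 \<partial>circle) = 0 \<longleftrightarrow> (AE z in circle. (cmod (f z))\<^sup>2 = 0)"
      by (intro integral_nonneg_eq_0_iff_AE) (auto dest: square_integrableD)
    then show "Re (\<integral>z. f z * cnj (f z) \<partial>circle) = 0 \<longleftrightarrow> eq_AE f (\<lambda>_. 0)"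
      using f by (simp add: inner_self eq_AE_def zero_square_integrable)
  qed
  show "norm a = sqrt (inner a a)"
    by (rule norm_L2_def)
  show "(uniformity :: (L2 \<times> L2) filter) = (INF e\<in>{0 <..}. principal {(x, y). dist x y < e})"
    by (rule uniformity_L2_def)
  show "open U \<longleftrightarrow> (\<forall>x\<in>U. \<forall>\<^sub>F (x', y) in uniformity. x' = x \<longrightarrow> y \<in> U)" for U :: "L2 set"
    by (rule open_L2_def)
qed

end

text \<open>Elements of \<open>L\<^sup>\<infinity>\<close> are represented by functions.\<close>

definition Linfinity :: "(complex \<Rightarrow> complex) set" where
  "Linfinity = {\<phi> \<in> borel_measurable circle. \<exists>C. AE z in circle. cmod (\<phi> z) \<le> C}"

definition Linfinity_norm :: "(complex \<Rightarrow> complex) \<Rightarrow> real" where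
  "Linfinity_norm \<phi> = real_of_ereal (esssup circle (\<lambda>z. ereal (cmod (\<phi> z))))"

lemma mult_square_integrable:
  assumes "\<phi> \<in> Linfinity" "f \<in> square_integrable"
  shows "(\<lambda>z. \<phi> z * f z) \<in> square_integrable"
proof -
  obtain C where C: "AE z in circle. cmod (\<phi> z) \<le> C"
    and [measurable]: "\<phi> \<in> borel_measurable circle"
    using assms(1) by (auto simp: Linfinity_def)
  note [measurable] = square_integrableD(1)[OF assms(2)]
  have "integrable circle (\<lambda>z. C\<^sup>2 * (cmod (f z))\<^sup>2)"
    using assms(2) by (auto dest: square_integrableD)
  then have "integrable circle (\<lambda>z. (cmod (\<phi> z * f z))\<^sup>2)"
  proof (rule Bochner_Integration.integrable_bound)
    show "AE z in circle. norm ((cmod (\<phi> z * f z))\<^sup>2) \<le> norm (C\<^sup>2 * (cmod (f z))\<^sup>2)"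
      using C by eventually_elim
        (auto simp: norm_mult power_mult_distrib intro!: mult_right_mono power_mono)
  qed measurable
  then show ?thesis
    by (simp add: square_integrable_def)
qed

text \<open>Zero is a junk value for functions that are not square integrable.\<close>

lift_definition L2_class :: "(complex \<Rightarrow> complex) \<Rightarrow> L2" is
  "\<lambda>f. if f \<in> square_integrable then f else (\<lambda>_. 0)"
  by (auto simp: eq_AE_def zero_square_integrable)

text \<open>Likewise for multiplication by a function outside \<open>L\<^sup>\<infinity>\<close>.\<close>

lift_definition multiplication :: "(complex \<Rightarrow> complex) \<Rightarrow> L2 \<Rightarrow> L2" is
  "\<lambda>\<phi> f. if \<phi> \<in> Linfinity then (\<lambda>z. \<phi> z * f z) else (\<lambda>_. 0)"
  by (auto simp: eq_AE_def zero_square_integrable mult_square_integrable)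

text \<open>On the circle \<open>z\<close> to the power \<open>-n\<close> is the conjugate of \<open>z\<close> to the power \<open>n\<close>.\<close>

lift_definition fourier_coeff :: "L2 \<Rightarrow> int \<Rightarrow> complex" is
  "\<lambda>f n. \<integral>z. f z * z powi (- n) \<partial>circle"
proof
  fix f g :: "complex \<Rightarrow> complex" and n :: int
  assume "eq_AE f g"
  then have *: "AE z in circle. f z = g z"
    and [measurable]: "f \<in> borel_measurable circle" "g \<in> borel_measurable circle"
    by (auto simp: eq_AE_def square_integrable_def)
  have "id \<in> borel_measurable circle"
    unfolding circle_def id_def
    by (intro measurable_completion) (simp add: measurable_restrict_space1)
  then have [measurable]: "(\<lambda>z. z) \<in> borel_measurable circle"
    by (simp add: id_def)
  have [measurable]: "(\<lambda>z. z powi (- n)) \<in> borel_measurable circle"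
    by (simp add: power_int_def)
  show "(\<integral>z. f z * z powi (- n) \<partial>circle) = (\<integral>z. g z * z powi (- n) \<partial>circle)"
    by (rule integral_cong_AE) (use * in auto)
qed

definition H2 :: "L2 set" where
  "H2 = {f. \<forall>n<0. fourier_coeff f n = 0}"

definition orth_proj :: "L2 set \<Rightarrow> L2 \<Rightarrow> L2" where
  "orth_proj M f = (THE g. g \<in> M \<and> (\<forall>h\<in>M. cinner (f - g) h = 0))"

text \<open>An operator on \<open>H2\<close> is a function on all of \<open>L\<^sup>2\<close> of which only the values on \<open>H2\<close> matter.\<close>

definition toeplitz :: "(complex \<Rightarrow> complex) \<Rightarrow> L2 \<Rightarrow> L2" where
  "toeplitz \<phi> f = orth_proj H2 (multiplication \<phi> f)"

lift_definition rational_on_circle :: "L2 \<Rightarrow> bool" is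
  "\<lambda>f. \<exists>p q :: complex poly. q \<noteq> 0 \<and> (AE z in circle. f z = poly p z / poly q z)"
proof -
  fix f g assume "eq_AE f g"
  then have "AE z in circle. f z = g z"
    by (simp add: eq_AE_def)
  then have "(AE z in circle. f z = h z) \<longleftrightarrow> (AE z in circle. g z = h z)" for h
    by (auto elim: AE_mp)
  then show "(\<exists>p q :: complex poly. q \<noteq> 0 \<and> (AE z in circle. f z = poly p z / poly q z)) \<longleftrightarrow>
             (\<exists>p q :: complex poly. q \<noteq> 0 \<and> (AE z in circle. g z = poly p z / poly q z))"
    by simp
qed

definition csubspace :: "L2 set \<Rightarrow> bool" where
  "csubspace M \<longleftrightarrow> 0 \<in> M \<and> (\<forall>x\<in>M. \<forall>y\<in>M. x + y \<in> M) \<and> (\<forall>c. \<forall>x\<in>M. scaleC c x \<in> M)"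

definition bounded_clinear_on :: "L2 set \<Rightarrow> L2 set \<Rightarrow> (L2 \<Rightarrow> L2) \<Rightarrow> bool" where
  "bounded_clinear_on H K T \<longleftrightarrow>
     T ` H \<subseteq> K \<and>
     (\<forall>x\<in>H. \<forall>y\<in>H. T (x + y) = T x + T y) \<and>
     (\<forall>c. \<forall>x\<in>H. T (scaleC c x) = scaleC c (T x)) \<and>
     (\<exists>B. \<forall>x\<in>H. norm (T x) \<le> B * norm x)"

text \<open>The norm of the restriction of \<open>T\<close> to \<open>M\<close>; \<^term>\<open>onorm\<close> is the case \<open>M = UNIV\<close>.\<close>

definition onorm_on :: "L2 set \<Rightarrow> (L2 \<Rightarrow> L2) \<Rightarrow> real" where
  "onorm_on M T = (SUP x\<in>M. norm (T x) / norm x)"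

definition norm_attaining_on :: "L2 set \<Rightarrow> (L2 \<Rightarrow> L2) \<Rightarrow> bool" where
  "norm_attaining_on M T \<longleftrightarrow> (\<exists>x\<in>M. norm x = 1 \<and> norm (T x) = onorm_on M T)"

definition AN_operators :: "L2 set \<Rightarrow> (L2 \<Rightarrow> L2) set" where
  "AN_operators H =
     {T. bounded_clinear_on H H T \<and>
         (\<forall>M. csubspace M \<and> closed M \<and> M \<subseteq> H \<and> M \<noteq> {0} \<longrightarrow> norm_attaining_on M T)}"

end

theory Submission
  imports Defs "HOL-Library.Nat_Bijection"
begin

text \<open>Write \<open>c\<close> for the norm of \<open>\<phi>\<close>. On \<open>H\<^sup>2\<close> the defect \<open>c\<^sup>2\<parallel>f\<parallel>\<^sup>2 - \<parallel>T\<^sub>\<phi> f\<parallel>\<^sup>2\<close> equals \<open>\<parallel>W f\<parallel>\<^sup>2\<close>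
  for the operator \<open>W f = (\<psi> f, (I - P)(\<phi> f))\<close>, where \<open>\<psi>\<^sup>2 = c\<^sup>2 - \<bar>\<phi>\<bar>\<^sup>2\<close>.

  If \<open>W q = 0\<close> for some nonzero polynomial \<open>q\<close>, then \<open>\<psi> = 0\<close>, so \<open>\<phi>\<close> has constant modulus, and
  \<open>q \<phi> \<in> H\<^sup>2\<close>, so \<open>q (I - P)\<phi>\<close> is a polynomial. Otherwise, high shifts of suitable
  polynomials make \<open>W\<close> arbitrarily small, and by linear algebra this can be achieved under finitely many
  linear constraints; one obtains orthonormal polynomials \<open>f\<^sub>n\<close> with pairwise orthogonal \<open>W f\<^sub>n \<noteq> 0\<close>
  tending to \<open>0\<close>, and on their closed span \<open>T\<^sub>\<phi>\<close> has norm \<open>c\<close>, which is not attained.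

  Conversely, if \<open>\<bar>\<phi>\<bar> = c\<close> and \<open>(I - P)\<phi> = p / q\<close>, then \<open>q \<phi> f \<in> H\<^sup>2\<close> for \<open>f \<in> H\<^sup>2\<close>. This is a linear
  recurrence for the negative Fourier coefficients of \<open>\<phi> f\<close>, so that \<open>\<phi> f \<in> H\<^sup>2\<close>, and hence
  \<open>\<parallel>T\<^sub>\<phi> f\<parallel> = c\<parallel>f\<parallel>\<close>, as soon as the first \<open>degree q\<close> of them vanish. A subspace of dimension greater than
  \<open>degree q\<close> contains such an \<open>f\<close>, and on a subspace of finite dimension every operator attains its norm.\<close>

subsection \<open>Integration on the circle\<close>

lemma measurable_id_circle [measurable]: "(\<lambda>z. z) \<in> borel_measurable circle"
  unfolding circle_def by (intro measurable_completion) (simp add: measurable_restrict_space1)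

lemma continuous_measurable_circle:
  assumes "continuous_on UNIV f"
  shows "f \<in> borel_measurable circle"
  using measurable_compose[OF measurable_id_circle borel_measurable_continuous_onI[OF assms]] by simp

lemma powi_measurable [measurable]: "(\<lambda>z :: complex. z powi n) \<in> borel_measurable circle"
  unfolding power_int_def by measurable

lemma integral_circle:
  fixes f :: "complex \<Rightarrow> 'a :: {banach, second_countable_topology}"
  assumes "f \<in> borel_measurable borel"
  shows "(\<integral>z. f z \<partial>circle) = (\<integral>t. f (cis t) \<partial>uniform_measure lborel {0..<2 * pi})"
proof -
  have cis: "cis \<in> uniform_measure lborel {0..<2 * pi} \<rightarrow>\<^sub>M restrict_space borel (sphere 0 1)"
    using measurable_cis by (simp cong: measurable_cong_sets)
  have f: "f \<in> borel_measurable (restrict_space borel (sphere 0 1))"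
    using assms by (rule measurable_restrict_space1)
  show ?thesis
    unfolding circle_def
    by (subst integral_completion) (use f cis in \<open>simp_all add: integral_distr\<close>)
qed

lemma AE_circle_in_sphere: "AE z in circle. cmod z = 1"
  by (rule AE_I2) (simp add: space_circle)

text \<open>For n \<noteq> 0 the function \<open>cis (n t)\<close> has the antiderivative
  \<open>cis (n t) / (i n)\<close>, which takes equal values at 0 and 2 pi. This is the
  orthonormality of the monomials.\<close>

lemma integral_powi: "(\<integral>z. z powi n \<partial>circle) = (if n = 0 then 1 else 0)"
proof (cases "n = 0")
  case True
  then show ?thesis
    using prob_space.prob_space[OF prob_space_circle] by simp
next
  case False
  let ?F = "\<lambda>t. cis (of_int n * t) / (\<i> * of_int n)"
  have [measurable]: "(\<lambda>t. cis (of_int n * t)) \<in> borel_measurable borel"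
    by (intro borel_measurable_continuous_onI continuous_intros)
  have cis_powi: "cis t powi n = cis (of_int n * t)" for t
    by (simp add: cis_power_int)
  have "(\<integral>z. z powi n \<partial>circle) = (\<integral>t. cis t powi n \<partial>uniform_measure lborel {0..<2 * pi})"
    by (rule integral_circle) (simp add: power_int_def)
  also have "\<dots> = (\<integral>t. cis t powi n \<partial>density lborel (\<lambda>t. ennreal (indicator {0..<2 * pi} t / (2 * pi))))"
    unfolding uniform_measure_def
    by (intro arg_cong2[where f = "integral\<^sup>L"] refl density_cong)
       (auto simp: divide_ennreal[symmetric] indicator_def)
  also have "\<dots> = (\<integral>t. (indicator {0..<2 * pi} t / (2 * pi)) *\<^sub>R cis t powi n \<partial>lborel)"
    by (subst integral_density) (auto simp: cis_powi)
  \<comment> \<open>The null point \<open>2 * pi\<close> is added, because the fundamental theorem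
    of calculus is applied on a closed interval.\<close>
  also have "\<dots> = (\<integral>t. (1 / (2 * pi)) *\<^sub>R (indicator {0..2 * pi} t *\<^sub>R cis (of_int n * t)) \<partial>lborel)"
  proof (rule integral_cong_AE)
    show "AE t in lborel. (indicator {0..<2 * pi} t / (2 * pi)) *\<^sub>R cis t powi n =
            (1 / (2 * pi)) *\<^sub>R (indicator {0..2 * pi} t *\<^sub>R cis (of_int n * t))"
      using AE_lborel_singleton[of "2 * pi"]
      by eventually_elim (auto simp: indicator_def cis_powi)
  qed (auto simp: cis_powi)
  also have "\<dots> = (1 / (2 * pi)) *\<^sub>R (\<integral>t. indicator {0..2 * pi} t *\<^sub>R cis (of_int n * t) \<partial>lborel)"
    by (rule Bochner_Integration.integral_scaleR_right)
  also have "(\<integral>t. indicator {0..2 * pi} t *\<^sub>R cis (of_int n * t) \<partial>lborel) = ?F (2 * pi) - ?F 0"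
  proof (rule integral_FTC_Icc)
    fix t :: real
    have "((\<lambda>z. exp (\<i> * of_int n * z) / (\<i> * of_int n)) has_field_derivative
        exp (\<i> * of_int n * of_real t)) (at (of_real t))"
      using False by (auto intro!: derivative_eq_intros)
    from has_vector_derivative_real_field[OF this]
    show "(?F has_vector_derivative cis (of_int n * t)) (at t within {0..2 * pi})"
      by (simp add: cis_conv_exp mult.assoc)
  qed (auto intro!: continuous_intros)
  also have "?F (2 * pi) - ?F 0 = 0"
    using cis_multiple_2pi[of "of_int n"] by (simp add: mult.commute)
  finally show ?thesis
    using False by simp
qed

text \<open>The preimage of a point under \<open>cis\<close> lies in a translate of 2 pi Z, so it is
  countable and Lebesgue null. The case w = 0 allows computing with negative powers of z; finitely
  many w take care of the zeros of a polynomial.\<close>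

lemma AE_circle_neq: "AE z in circle. z \<noteq> w"
proof -
  have "countable {t. cis t = w}"
  proof (cases "\<exists>s. cis s = w")
    case True
    then obtain s where s: "cis s = w" by auto
    have "{t. cis t = w} \<subseteq> range (\<lambda>k::int. s + 2 * pi * of_int k)"
    proof
      fix t assume "t \<in> {t. cis t = w}"
      then have "sin t = sin s \<and> cos t = cos s"
        using s by (metis cis.sel mem_Collect_eq)
      then obtain k :: int where "t = s + 2 * pi * of_int k"
        using sin_cos_eq_iff by blast
      then show "t \<in> range (\<lambda>k::int. s + 2 * pi * of_int k)" by auto
    qed
    then show ?thesis
      by (rule countable_subset) auto
  qed auto
  then have "AE t in lborel. t \<notin> {t. cis t = w}"
    by (intro AE_not_in countable_imp_null_set_lborel)
  then have "AE t in uniform_measure lborel {0..<2 * pi}. cis t \<noteq> w"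
    by (subst AE_uniform_measure) auto
  moreover have "cis \<in> uniform_measure lborel {0..<2 * pi} \<rightarrow>\<^sub>M restrict_space borel (sphere 0 1)"
    using measurable_cis by (simp cong: measurable_cong_sets)
  moreover have "{z \<in> space (restrict_space borel (sphere 0 1)). z \<noteq> w}
      \<in> sets (restrict_space borel (sphere 0 1))"
    by (auto simp: sets_restrict_space space_restrict_space image_iff Int_def
        intro!: exI[of _ "- {w}"] bexI[of _ "- {w}"])
  ultimately have "AE z in distr (uniform_measure lborel {0..<2 * pi})
      (restrict_space borel (sphere 0 1)) cis. z \<noteq> w"
    by (subst AE_distr_iff) auto
  then show ?thesis
    unfolding circle_def by (rule AE_completion)
qed

lemma AE_poly_nonzero:
  assumes "q \<noteq> (0 :: complex poly)"
  shows "AE z in circle. poly q z \<noteq> 0"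
proof -
  have "AE z in circle. \<forall>w\<in>{w. poly q w = 0}. z \<noteq> w"
    using poly_roots_finite[OF assms] AE_circle_neq by (intro AE_finite_allI)
  then show ?thesis by eventually_elim auto
qed

subsection \<open>The Hilbert space of square integrable functions\<close>

lemma L2_class_abs: "f \<in> square_integrable \<Longrightarrow> L2_class f = abs_L2 f"
  by (simp add: L2_class_def)

lemma eq_AE_refl: "eq_AE f f \<longleftrightarrow> f \<in> square_integrable"
  by (simp add: eq_AE_def)

lemma L2_class_cases:
  obtains u where "u \<in> square_integrable" "f = L2_class u"
proof -
  have "eq_AE (rep_L2 f) (rep_L2 f)" "abs_L2 (rep_L2 f) = f"
    by (rule Quotient_rep_reflp[OF Quotient_L2] Quotient_abs_rep[OF Quotient_L2])+
  then show ?thesis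
    using that[of "rep_L2 f"] by (simp add: L2_class_abs eq_AE_refl)
qed

lemma L2_class_eq_iff:
  assumes "u \<in> square_integrable" "v \<in> square_integrable"
  shows "L2_class u = L2_class v \<longleftrightarrow> (AE z in circle. u z = v z)"
proof -
  have "abs_L2 u = abs_L2 v \<longleftrightarrow> eq_AE u v"
    using Quotient_rel[OF Quotient_L2, of u v] assms by (auto simp: eq_AE_refl)
  then show ?thesis
    using assms by (simp add: L2_class_abs) (simp add: eq_AE_def)
qed

lemma L2_class_zero: "L2_class (\<lambda>_. 0) = 0"
  by (simp add: L2_class_abs zero_square_integrable zero_L2_def)

lemma L2_class_add:
  assumes "u \<in> square_integrable" "v \<in> square_integrable"
  shows "L2_class u + L2_class v = L2_class (\<lambda>z. u z + v z)"
  using assms by (simp add: L2_class_abs add_square_integrable plus_L2.abs_eq eq_AE_refl)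

lemma L2_class_scaleC:
  assumes "u \<in> square_integrable"
  shows "scaleC c (L2_class u) = L2_class (\<lambda>z. c * u z)"
  using assms by (simp add: L2_class_abs scale_square_integrable scaleC.abs_eq eq_AE_refl)

lemma diff_square_integrable:
  assumes "u \<in> square_integrable" "v \<in> square_integrable"
  shows "(\<lambda>z. u z - v z) \<in> square_integrable"
  using add_square_integrable[OF assms(1) scale_square_integrable[OF assms(2), of "-1"]] by simp

lemma L2_class_diff:
  assumes "u \<in> square_integrable" "v \<in> square_integrable"
  shows "L2_class u - L2_class v = L2_class (\<lambda>z. u z - v z)"
  unfolding minus_L2_def uminus_L2_def
  using assms L2_class_add[OF assms(1) scale_square_integrable[OF assms(2), of "-1"]]
  by (simp add: L2_class_scaleC)

lemma cinner_L2_class: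
  assumes "u \<in> square_integrable" "v \<in> square_integrable"
  shows "cinner (L2_class u) (L2_class v) = (\<integral>z. u z * cnj (v z) \<partial>circle)"
  using assms by (simp add: L2_class_abs cinner.abs_eq eq_AE_refl)

lemma multiplication_L2_class:
  assumes "\<phi> \<in> Linfinity" "u \<in> square_integrable"
  shows "multiplication \<phi> (L2_class u) = L2_class (\<lambda>z. \<phi> z * u z)"
  using assms by (simp add: L2_class_abs multiplication.abs_eq eq_AE_refl mult_square_integrable)

lemma fourier_coeff_L2_class:
  assumes "u \<in> square_integrable"
  shows "fourier_coeff (L2_class u) n = (\<integral>z. u z * z powi (- n) \<partial>circle)"
  using assms by (simp add: L2_class_abs fourier_coeff.abs_eq eq_AE_refl)

lemma rational_on_circle_L2_class:
  assumes "u \<in> square_integrable"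
  shows "rational_on_circle (L2_class u) \<longleftrightarrow>
    (\<exists>p q :: complex poly. q \<noteq> 0 \<and> (AE z in circle. u z = poly p z / poly q z))"
  using assms by (simp add: L2_class_abs rational_on_circle.abs_eq eq_AE_refl)

lemma norm_L2_class:
  assumes "u \<in> square_integrable"
  shows "(norm (L2_class u))\<^sup>2 = (\<integral>z. (cmod (u z))\<^sup>2 \<partial>circle)"
proof -
  have "(norm (L2_class u))\<^sup>2 = Re (\<integral>z. u z * cnj (u z) \<partial>circle)"
    using assms by (simp add: power2_norm_eq_inner inner_L2_def cinner_L2_class)
  also have "(\<integral>z. u z * cnj (u z) \<partial>circle) = (\<integral>z. complex_of_real ((cmod (u z))\<^sup>2) \<partial>circle)"
    by (simp only: complex_norm_square)
  also have "\<dots> = complex_of_real (\<integral>z. (cmod (u z))\<^sup>2 \<partial>circle)"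
    by (rule integral_complex_of_real)
  finally show ?thesis by simp
qed

lemma nn_integral_norm_L2_class:
  assumes "u \<in> square_integrable"
  shows "(\<integral>\<^sup>+z. ennreal ((cmod (u z))\<^sup>2) \<partial>circle) = ennreal ((norm (L2_class u))\<^sup>2)"
  using assms by (simp add: norm_L2_class nn_integral_eq_integral square_integrableD)

lemma norm_L2_class_mono:
  assumes "u \<in> square_integrable" "v \<in> square_integrable"
    and "AE z in circle. cmod (u z) \<le> cmod (v z)"
  shows "norm (L2_class u) \<le> norm (L2_class v)"
proof (rule power2_le_imp_le)
  show "(norm (L2_class u))\<^sup>2 \<le> (norm (L2_class v))\<^sup>2"
    unfolding norm_L2_class[OF assms(1)] norm_L2_class[OF assms(2)]
    by (rule integral_mono_AE)
       (use assms in \<open>auto dest: square_integrableD elim!: eventually_mono\<close>)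
qed simp

section \<open>Essentially bounded functions\<close>

lemma Linfinity_square_integrable:
  assumes "\<phi> \<in> Linfinity"
  shows "\<phi> \<in> square_integrable"
proof -
  interpret prob_space circle by (rule prob_space_circle)
  have "(\<lambda>_. 1) \<in> square_integrable"
    by (simp add: square_integrable_def)
  from mult_square_integrable[OF assms this] show ?thesis by simp
qed

lemma continuous_Linfinity:
  fixes f :: "complex \<Rightarrow> complex"
  assumes "continuous_on UNIV f"
  shows "f \<in> Linfinity"
proof -
  have "compact (f ` sphere 0 1)"
    by (intro compact_continuous_image continuous_on_subset[OF assms]) auto
  then obtain C where "\<forall>w\<in>f ` sphere 0 1. norm w \<le> C"
    using compact_imp_bounded bounded_iff by blast
  then have "AE z in circle. cmod (f z) \<le> C"
    by (intro AE_I2) (simp add: space_circle)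
  then show ?thesis
    using continuous_measurable_circle[OF assms] by (auto simp: Linfinity_def)
qed

lemma poly_Linfinity: "poly p \<in> Linfinity" for p :: "complex poly"
  by (intro continuous_Linfinity continuous_intros)

lemma powi_Linfinity: "(\<lambda>z. z powi n) \<in> Linfinity"
proof -
  have "AE z in circle. cmod (z powi n) \<le> 1"
    using AE_circle_in_sphere by eventually_elim (simp add: norm_power_int)
  then show ?thesis by (auto simp: Linfinity_def)
qed

lemma mult_Linfinity:
  assumes "\<phi> \<in> Linfinity" "\<psi> \<in> Linfinity"
  shows "(\<lambda>z. \<phi> z * \<psi> z) \<in> Linfinity"
proof -
  obtain C D where C: "AE z in circle. cmod (\<phi> z) \<le> C" and D: "AE z in circle. cmod (\<psi> z) \<le> D"
    and [measurable]: "\<phi> \<in> borel_measurable circle" "\<psi> \<in> borel_measurable circle"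
    using assms by (auto simp: Linfinity_def)
  have "AE z in circle. cmod (\<phi> z * \<psi> z) \<le> C * D"
    using C D by eventually_elim
      (auto simp: norm_mult intro!: mult_mono intro: order_trans[OF norm_ge_zero])
  then show ?thesis by (auto simp: Linfinity_def)
qed

section \<open>Complex scalars and the complex inner product\<close>

lemma scaleC_add_right: "scaleC c (f + g) = scaleC c f + scaleC c g"
  by transfer (auto simp: eq_AE_def ring_distribs intro!: add_square_integrable scale_square_integrable)

lemma scaleC_add_left: "scaleC (a + b) f = scaleC a f + scaleC b f"
  by transfer (auto simp: eq_AE_def ring_distribs intro!: add_square_integrable scale_square_integrable)

lemma scaleC_scaleC [simp]: "scaleC a (scaleC b f) = scaleC (a * b) f"
  by transfer (auto simp: eq_AE_def mult.assoc intro!: scale_square_integrable)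

lemma scaleC_of_real: "scaleC (of_real r) f = r *\<^sub>R f"
  by (simp add: scaleR_L2_def)

lemma scaleC_zero_left [simp]: "scaleC 0 f = 0"
  using scaleC_of_real[of 0 f] by simp

lemma scaleC_minus_one: "scaleC (-1) f = - f"
  by (simp add: uminus_L2_def)

lemma cinner_add_left: "cinner (f + g) h = cinner f h + cinner g h"
  by transfer (auto simp: eq_AE_def integrable_product ring_distribs)

lemma cinner_scaleC_left: "cinner (scaleC c f) h = c * cinner f h"
  by transfer (auto simp: eq_AE_def integrable_product mult.assoc)

lemma cinner_commute: "cinner f g = cnj (cinner g f)"
proof transfer
  fix f g
  have "(\<integral>z. f z * cnj (g z) \<partial>circle) = (\<integral>z. cnj (g z * cnj (f z)) \<partial>circle)"
    by (simp add: mult.commute)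
  also have "\<dots> = cnj (\<integral>z. g z * cnj (f z) \<partial>circle)"
    by (rule Bochner_Integration.integral_cnj)
  finally show "(\<integral>z. f z * cnj (g z) \<partial>circle) = cnj (\<integral>z. g z * cnj (f z) \<partial>circle)" .
qed

lemma cinner_self: "cinner f f = of_real ((norm f)\<^sup>2)"
proof -
  have "Im (cinner f f) = 0"
    using cinner_commute[of f f] by (auto simp: complex_eq_iff)
  then show ?thesis
    by (simp add: complex_eq_iff power2_norm_eq_inner inner_L2_def)
qed

lemma cinner_add_right: "cinner f (g + h) = cinner f g + cinner f h"
  by (subst (1 2 3) cinner_commute) (simp add: cinner_add_left)

lemma cinner_scaleC_right: "cinner f (scaleC c g) = cnj c * cinner f g"
  by (subst (1 2) cinner_commute) (simp add: cinner_scaleC_left)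

lemma cinner_zero_left [simp]: "cinner 0 f = 0"
  using cinner_scaleC_left[of 0 0 f] by simp

lemma cinner_diff_left: "cinner (f - g) h = cinner f h - cinner g h"
  using cinner_scaleC_left[of "-1" g h] cinner_add_left[of f "-g" h] by (simp add: scaleC_minus_one)

lemma cinner_sum_left: "cinner (\<Sum>i\<in>A. f i) h = (\<Sum>i\<in>A. cinner (f i) h)"
  by (induction A rule: infinite_finite_induct) (auto simp: cinner_add_left)

lemma norm_scaleC: "norm (scaleC c f) = cmod c * norm f"
proof -
  have "complex_of_real ((norm (scaleC c f))\<^sup>2) = of_real ((cmod c * norm f)\<^sup>2)"
    unfolding cinner_self[symmetric] power_mult_distrib of_real_mult complex_norm_square
    by (simp add: cinner_scaleC_left cinner_scaleC_right)
  then have "(norm (scaleC c f))\<^sup>2 = (cmod c * norm f)\<^sup>2"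
    by (simp only: of_real_eq_iff)
  then show ?thesis by simp
qed

text \<open>A unimodular factor \<open>a\<close> rotates f so that the complex inner product becomes
  its modulus; the Cauchy-Schwarz inequality of the real inner product then applies.\<close>

lemma cmod_cinner_le: "cmod (cinner f g) \<le> norm f * norm g"
proof (cases "cinner f g = 0")
  case False
  define a where "a = cnj (sgn (cinner f g))"
  have a: "cmod a = 1"
    using False by (simp add: a_def norm_sgn)
  have "a * cinner f g = of_real (cmod (cinner f g))"
    using False by (simp add: a_def sgn_eq field_simps complex_norm_square[symmetric] power2_eq_square)
  then have "cmod (cinner f g) = inner (scaleC a f) g"
    by (simp add: inner_L2_def cinner_scaleC_left)
  also have "\<dots> \<le> norm (scaleC a f) * norm g"
    by (rule norm_cauchy_schwarz)
  finally show ?thesis by (simp add: norm_scaleC a)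
qed simp

lemma bounded_linear_scaleC: "bounded_linear (scaleC c)"
  by (rule bounded_linear_intro[where K = "cmod c"])
     (auto simp: scaleC_add_right norm_scaleC scaleC_of_real[symmetric] mult.commute)

lemma bounded_linear_cinner_left: "bounded_linear (\<lambda>f. cinner f g)"
  by (rule bounded_linear_intro[where K = "norm g"])
     (auto simp: cinner_add_left scaleC_of_real[symmetric] cinner_scaleC_left cmod_cinner_le
        scaleR_conv_of_real)

lemma bounded_linear_cinner_right: "bounded_linear (\<lambda>g. cinner f g)"
  by (rule bounded_linear_intro[where K = "norm f"])
     (auto simp: cinner_add_right scaleC_of_real[symmetric] cinner_scaleC_right
        scaleR_conv_of_real order_trans[OF cmod_cinner_le] mult.commute)

lemma norm_add_orthogonal:
  assumes "cinner f g = 0"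
  shows "(norm (f + g))\<^sup>2 = (norm f)\<^sup>2 + (norm g)\<^sup>2"
proof -
  have "inner f g = 0"
    using assms by (simp add: inner_L2_def)
  then show ?thesis
    by (simp add: power2_norm_eq_inner inner_add_left inner_add_right inner_commute)
qed

lemma norm_sum_orthogonal:
  assumes "finite A" "\<And>i j. i \<in> A \<Longrightarrow> j \<in> A \<Longrightarrow> i \<noteq> j \<Longrightarrow> cinner (f i) (f j) = 0"
  shows "(norm (\<Sum>i\<in>A. f i))\<^sup>2 = (\<Sum>i\<in>A. (norm (f i))\<^sup>2)"
  using assms
proof (induction A rule: finite_induct)
  case (insert a A)
  have "cinner (\<Sum>i\<in>A. f i) (f a) = 0"
    unfolding cinner_sum_left using insert by (intro sum.neutral) auto
  then have "cinner (f a) (\<Sum>i\<in>A. f i) = 0"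
    by (subst cinner_commute) simp
  then show ?case
    using insert by (simp add: norm_add_orthogonal)
qed simp

subsection \<open>Completeness\<close>

text \<open>Cauchy-Schwarz for |u| against the constant 1, which has norm 1 in a probability
  space.\<close>

lemma integral_cmod_le_norm:
  assumes "u \<in> square_integrable"
  shows "integrable circle (\<lambda>z. cmod (u z))" "(\<integral>z. cmod (u z) \<partial>circle) \<le> norm (L2_class u)"
proof -
  interpret prob_space circle by (rule prob_space_circle)
  have one: "(\<lambda>_. 1) \<in> square_integrable"
    by (simp add: square_integrable_def)
  have abs: "(\<lambda>z. complex_of_real (cmod (u z))) \<in> square_integrable"
    using square_integrableD[OF assms] by (simp add: square_integrable_def)
  have "integrable circle (\<lambda>z. complex_of_real (cmod (u z)))"
    using integrable_product[OF abs one] by simp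
  then show "integrable circle (\<lambda>z. cmod (u z))"
    by (simp add: complex_of_real_integrable_eq)
  have n1: "(norm (L2_class (\<lambda>_. 1)))\<^sup>2 = 1"
    using one prob_space by (simp add: norm_L2_class)
  have "cinner (L2_class (\<lambda>z. complex_of_real (cmod (u z)))) (L2_class (\<lambda>_. 1)) =
      of_real (\<integral>z. cmod (u z) \<partial>circle)"
    by (simp add: cinner_L2_class abs one)
  then have "\<bar>\<integral>z. cmod (u z) \<partial>circle\<bar> \<le> norm (L2_class (\<lambda>z. complex_of_real (cmod (u z)))) *
      norm (L2_class (\<lambda>_. 1))"
    using cmod_cinner_le[of "L2_class (\<lambda>z. complex_of_real (cmod (u z)))" "L2_class (\<lambda>_. 1)"]
    by simp
  also have "\<dots> \<le> norm (L2_class u)"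
    using n1 norm_L2_class_mono[OF abs assms] norm_ge_zero[of "L2_class (\<lambda>_. 1)"]
    by (auto simp: power2_eq_1_iff)
  finally show "(\<integral>z. cmod (u z) \<partial>circle) \<le> norm (L2_class u)" by simp
qed

text \<open>The series of the |d k| has finite integral, hence is finite almost everywhere, and
  there the telescoping series of the increments converges absolutely.\<close>

lemma AE_convergent_of_summable_norm:
  assumes u: "\<And>k. u k \<in> square_integrable"
    and sum: "summable (\<lambda>k. norm (L2_class (u (Suc k)) - L2_class (u k)))"
  shows "AE z in circle. convergent (\<lambda>k. u k z)"
proof -
  note [measurable] = square_integrableD(1)[OF u]
  define d where "d k z = u (Suc k) z - u k z" for k z
  have d: "d k \<in> square_integrable" for k
    unfolding d_def by (intro diff_square_integrable u)
  note [measurable] = square_integrableD(1)[OF d]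
  have norm_d: "norm (L2_class (d k)) = norm (L2_class (u (Suc k)) - L2_class (u k))" for k
    unfolding d_def by (simp add: L2_class_diff u)
  have "(\<integral>\<^sup>+z. (\<Sum>k. ennreal (cmod (d k z))) \<partial>circle) = (\<Sum>k. \<integral>\<^sup>+z. ennreal (cmod (d k z)) \<partial>circle)"
    by (rule nn_integral_suminf) measurable
  also have "\<dots> = (\<Sum>k. ennreal (\<integral>z. cmod (d k z) \<partial>circle))"
    using integral_cmod_le_norm(1)[OF d] by (simp add: nn_integral_eq_integral)
  also have "\<dots> \<le> (\<Sum>k. ennreal (norm (L2_class (d k))))"
    by (intro suminf_le ennreal_leI integral_cmod_le_norm d) auto
  also have "\<dots> < \<infinity>"
    using sum by (subst suminf_ennreal2) (auto simp: norm_d)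
  finally have "AE z in circle. (\<Sum>k. ennreal (cmod (d k z))) \<noteq> \<infinity>"
    by (intro nn_integral_PInf_AE) auto
  then show ?thesis
  proof eventually_elim
    case (elim z)
    then have "summable (\<lambda>k. cmod (d k z))"
      by (intro summable_suminf_not_top) auto
    then have "summable (\<lambda>k. d k z)"
      by (rule summable_norm_cancel)
    then obtain l where "(\<lambda>n. \<Sum>k<n. d k z) \<longlonglongrightarrow> l"
      unfolding summable_def sums_def by auto
    then have "(\<lambda>n. u n z - u 0 z) \<longlonglongrightarrow> l"
      by (simp add: d_def sum_lessThan_telescope[where f = "\<lambda>n. u n z"])
    then have "(\<lambda>n. u n z - u 0 z + u 0 z) \<longlonglongrightarrow> l + u 0 z"
      by (intro tendsto_intros)
    then show ?case by (auto simp: convergent_def)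
  qed
qed

text \<open>Riesz-Fischer: a rapidly converging subsequence converges almost everywhere, and Fatou's
  lemma shows that its pointwise limit is also the limit in the norm.\<close>

instance L2 :: complete_space
proof
  fix X :: "nat \<Rightarrow> L2"
  assume "Cauchy X"
  then have "\<forall>k. \<exists>N. \<forall>m\<ge>N. \<forall>n\<ge>N. norm (X m - X n) < (1 / 2) ^ k"
    by (auto simp: Cauchy_iff)
  then obtain N where N: "\<And>k m n. m \<ge> N k \<Longrightarrow> n \<ge> N k \<Longrightarrow> norm (X m - X n) < (1 / 2) ^ k"
    by metis
  \<comment> \<open>Summation makes \<open>r j\<close> at least \<open>N k\<close> for every k \<le>
    j, so both \<open>r k\<close> and \<open>r (Suc k)\<close> lie beyond
    \<open>N k\<close>.\<close>
  define r where "r k = (\<Sum>i\<le>k. N i)" for k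
  have r: "N k \<le> r j" if "k \<le> j" for k j
    unfolding r_def using that by (intro member_le_sum) auto
  have "\<forall>n. \<exists>u. u \<in> square_integrable \<and> X n = L2_class u"
    by (metis L2_class_cases)
  then obtain u where u: "\<And>n. u n \<in> square_integrable" and X: "\<And>n. X n = L2_class (u n)"
    by metis
  note [measurable] = square_integrableD(1)[OF u]
  have "summable (\<lambda>k. norm (X (r (Suc k)) - X (r k)))"
    by (rule summable_comparison_test'[OF summable_geometric[of "1 / 2 :: real"]])
       (auto intro!: less_imp_le N r)
  then have conv: "AE z in circle. convergent (\<lambda>k. u (r k) z)"
    by (intro AE_convergent_of_summable_norm u) (simp add: X)
  \<comment> \<open>Where the subsequence diverges, \<open>lim\<close> is an arbitrary value; this
    happens only on a null set.\<close>
  define v where "v z = lim (\<lambda>k. u (r k) z)" for z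
  have [measurable]: "v \<in> borel_measurable circle"
    unfolding v_def by measurable
  \<comment> \<open>Fatou's lemma along the subsequence yields the integrability and the estimate at
    once.\<close>
  have bound: "(\<lambda>z. u m z - v z) \<in> square_integrable \<and>
      norm (L2_class (\<lambda>z. u m z - v z)) \<le> (1 / 2) ^ k" if m: "m \<ge> N k" for m k
  proof -
    have "(\<integral>\<^sup>+z. ennreal ((cmod (u m z - v z))\<^sup>2) \<partial>circle) =
        (\<integral>\<^sup>+z. liminf (\<lambda>j. ennreal ((cmod (u m z - u (r j) z))\<^sup>2)) \<partial>circle)"
    proof (rule nn_integral_cong_AE)
      show "AE z in circle. ennreal ((cmod (u m z - v z))\<^sup>2) =
          liminf (\<lambda>j. ennreal ((cmod (u m z - u (r j) z))\<^sup>2))"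
        using conv
      proof eventually_elim
        case (elim z)
        then have "(\<lambda>k. u (r k) z) \<longlonglongrightarrow> v z"
          by (simp add: v_def convergent_LIMSEQ_iff)
        then have "(\<lambda>j. ennreal ((cmod (u m z - u (r j) z))\<^sup>2)) \<longlonglongrightarrow> ennreal ((cmod (u m z - v z))\<^sup>2)"
          by (intro tendsto_ennrealI tendsto_intros)
        then show ?case
          by (intro lim_imp_Liminf[symmetric]) auto
      qed
    qed
    also have "\<dots> \<le> liminf (\<lambda>j. \<integral>\<^sup>+z. ennreal ((cmod (u m z - u (r j) z))\<^sup>2) \<partial>circle)"
      by (rule nn_integral_liminf) measurable
    also have "\<dots> \<le> ennreal (((1 / 2) ^ k)\<^sup>2)"
    proof (rule Liminf_le)
      show "\<forall>\<^sub>F j in sequentially. (\<integral>\<^sup>+z. ennreal ((cmod (u m z - u (r j) z))\<^sup>2) \<partial>circle)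
          \<le> ennreal (((1 / 2) ^ k)\<^sup>2)"
        using eventually_ge_at_top[of k]
      proof eventually_elim
        case (elim j)
        have "norm (X m - X (r j)) \<le> (1 / 2) ^ k"
          using N[OF m r[OF elim]] by simp
        then have "norm (L2_class (\<lambda>z. u m z - u (r j) z)) \<le> (1 / 2) ^ k"
          by (simp add: X L2_class_diff u)
        then show ?case
          by (subst nn_integral_norm_L2_class)
             (auto intro!: diff_square_integrable u ennreal_leI power_mono simp del: power_divide)
      qed
    qed simp
    finally have le: "(\<integral>\<^sup>+z. ennreal ((cmod (u m z - v z))\<^sup>2) \<partial>circle) \<le> ennreal (((1 / 2) ^ k)\<^sup>2)" .
    then have "integrable circle (\<lambda>z. (cmod (u m z - v z))\<^sup>2)"
      by (intro integrableI_bounded) (auto intro: le_less_trans)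
    then have si: "(\<lambda>z. u m z - v z) \<in> square_integrable"
      by (simp add: square_integrable_def)
    from le have "(norm (L2_class (\<lambda>z. u m z - v z)))\<^sup>2 \<le> ((1 / 2) ^ k)\<^sup>2"
      unfolding nn_integral_norm_L2_class[OF si] by (subst (asm) ennreal_le_iff) auto
    then show ?thesis
      using si by (auto intro: power2_le_imp_le)
  qed
  \<comment> \<open>\<open>v\<close> is \<open>u (N 0)\<close> minus the square integrable
    difference \<open>u (N 0) - v\<close>.\<close>
  have v: "v \<in> square_integrable"
    using diff_square_integrable[OF u conjunct1[OF bound[OF order_refl]], of "N 0" 0] by simp
  have "X \<longlonglongrightarrow> L2_class v"
  proof (rule LIMSEQ_I)
    fix e :: real assume "0 < e"
    then obtain k where "(1 / 2) ^ k < e"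
      using real_arch_pow_inv[of e "1 / 2"] by auto
    then have "norm (X m - L2_class v) < e" if "m \<ge> N k" for m
      using bound[OF that] by (simp add: X L2_class_diff u v)
    then show "\<exists>M. \<forall>m\<ge>M. norm (X m - L2_class v) < e" by blast
  qed
  then show "convergent X" by (auto simp: convergent_def)
qed

instance L2 :: banach ..

subsection \<open>Fourier coefficients\<close>

definition monomial_L2 :: "int \<Rightarrow> L2" where
  "monomial_L2 n = L2_class (\<lambda>z. z powi n)"

lemma powi_square_integrable: "(\<lambda>z. z powi n) \<in> square_integrable"
  by (intro Linfinity_square_integrable powi_Linfinity)

lemma cnj_powi_on_circle:
  assumes "cmod z = 1"
  shows "cnj (z powi n) = z powi (- n)"
proof -
  have "z * cnj z = 1"
    using assms by (simp add: complex_norm_square[symmetric])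
  then have "cnj z = inverse z"
    by (metis inverse_unique)
  then show ?thesis
    by (simp add: power_int_minus power_int_inverse)
qed

text \<open>On the circle the power -n of z is the conjugate of its power n. Coefficients thereby
  become bounded linear functionals, which commute with convergent series.\<close>

lemma fourier_coeff_eq_cinner: "fourier_coeff f n = cinner f (monomial_L2 n)"
proof -
  obtain u where u: "u \<in> square_integrable" "f = L2_class u"
    by (rule L2_class_cases)
  note [measurable] = square_integrableD(1)[OF u(1)]
  have [measurable]: "(\<lambda>z. cnj (z powi n)) \<in> borel_measurable circle"
    by (rule measurable_compose[OF powi_measurable]) (rule borel_measurable_cnj)
  have "(\<integral>z. u z * z powi (- n) \<partial>circle) = (\<integral>z. u z * cnj (z powi n) \<partial>circle)"
    by (rule integral_cong_AE)
       (use AE_circle_in_sphere in \<open>auto elim!: eventually_mono simp: cnj_powi_on_circle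
          simp del: complex_cnj_power_int\<close>)
  then show ?thesis
    using u by (simp add: fourier_coeff_L2_class monomial_L2_def cinner_L2_class powi_square_integrable)
qed

lemma fourier_coeff_monomial: "fourier_coeff (monomial_L2 m) n = (if m = n then 1 else 0)"
proof -
  have "fourier_coeff (monomial_L2 m) n = (\<integral>z. z powi m * z powi (- n) \<partial>circle)"
    unfolding monomial_L2_def by (rule fourier_coeff_L2_class) (rule powi_square_integrable)
  also have "\<dots> = (\<integral>z. z powi (m - n) \<partial>circle)"
  proof (rule integral_cong_AE)
    show "AE z in circle. z powi m * z powi (- n) = z powi (m - n)"
      using AE_circle_neq[of 0]
      by eventually_elim (simp flip: power_int_add)
  qed auto
  finally show ?thesis by (simp add: integral_powi)
qed

lemma cinner_monomial: "cinner (monomial_L2 m) (monomial_L2 n) = (if m = n then 1 else 0)"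
  by (simp flip: fourier_coeff_eq_cinner add: fourier_coeff_monomial)

lemma norm_monomial [simp]: "norm (monomial_L2 n) = 1"
proof -
  have "complex_of_real ((norm (monomial_L2 n))\<^sup>2) = of_real 1"
    by (simp only: cinner_self[symmetric] cinner_monomial) simp
  then have "(norm (monomial_L2 n))\<^sup>2 = 1"
    by (simp only: of_real_eq_iff)
  then show ?thesis
    by (metis norm_ge_zero power2_eq_1_iff neg_0_le_iff_le not_one_le_zero)
qed

lemma bounded_linear_fourier_coeff: "bounded_linear (\<lambda>f. fourier_coeff f n)"
  unfolding fourier_coeff_eq_cinner by (rule bounded_linear_cinner_left)

lemma fourier_coeff_scaleC: "fourier_coeff (scaleC c f) n = c * fourier_coeff f n"
  by (simp add: fourier_coeff_eq_cinner cinner_scaleC_left)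

lemmas fourier_coeff_add = linear_add[OF bounded_linear.linear[OF bounded_linear_fourier_coeff]]
lemmas fourier_coeff_diff = linear_diff[OF bounded_linear.linear[OF bounded_linear_fourier_coeff]]
lemmas fourier_coeff_sum = linear_sum[OF bounded_linear.linear[OF bounded_linear_fourier_coeff]]
lemmas fourier_coeff_zero = linear_0[OF bounded_linear.linear[OF bounded_linear_fourier_coeff]]

text \<open>By Stone--Weierstrass a function with vanishing Fourier
  coefficients is orthogonal to continuous functions, hence to indicators of Borel sets, hence zero.\<close>

definition trig_null :: "(complex \<Rightarrow> complex) \<Rightarrow> bool" where
  "trig_null u \<longleftrightarrow> integrable circle u \<and> (\<forall>n. (\<integral>z. u z * z powi n \<partial>circle) = 0)"

lemma integrable_times_bounded:
  assumes "integrable circle u" "g \<in> Linfinity"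
  shows "integrable circle (\<lambda>z. u z * g z)"
proof -
  obtain C where C: "AE z in circle. cmod (g z) \<le> C"
    and [measurable]: "g \<in> borel_measurable circle"
    using assms(2) by (auto simp: Linfinity_def)
  have [measurable]: "u \<in> borel_measurable circle"
    using assms(1) by auto
  have "integrable circle (\<lambda>z. C * cmod (u z))"
    using assms(1) by auto
  then show ?thesis
  proof (rule Bochner_Integration.integrable_bound)
    show "AE z in circle. norm (u z * g z) \<le> norm (C * cmod (u z))"
      using C
    proof eventually_elim
      case (elim z)
      then have "cmod (u z) * cmod (g z) \<le> cmod (u z) * C"
        by (intro mult_left_mono) auto
      then show ?case
        by (simp add: norm_mult mult.commute)
    qed
  qed measurable
qed

lemma trig_null_add:
  assumes "trig_null u" "trig_null v"
  shows "trig_null (\<lambda>z. u z + v z)"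
  using assms by (auto simp: trig_null_def ring_distribs integrable_times_bounded powi_Linfinity)

lemma trig_null_scale:
  assumes "trig_null u"
  shows "trig_null (\<lambda>z. c * u z)"
  using assms by (auto simp: trig_null_def mult.assoc)

lemma trig_null_shift:
  assumes "trig_null u"
  shows "trig_null (\<lambda>z. u z * z powi n)"
proof -
  have [measurable]: "u \<in> borel_measurable circle"
    using assms by (auto simp: trig_null_def)
  have "(\<integral>z. u z * z powi n * z powi m \<partial>circle) = (\<integral>z. u z * z powi (n + m) \<partial>circle)" for m
  proof (rule integral_cong_AE)
    show "AE z in circle. u z * z powi n * z powi m = u z * z powi (n + m)"
      using AE_circle_neq[of 0] by eventually_elim (simp add: power_int_add)
  qed auto
  then show ?thesis
    using assms by (auto simp: trig_null_def integrable_times_bounded powi_Linfinity)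
qed

lemma trig_null_cong:
  assumes "trig_null u" "v \<in> borel_measurable circle" "AE z in circle. u z = v z"
  shows "trig_null v"
proof -
  have [measurable]: "u \<in> borel_measurable circle" "v \<in> borel_measurable circle"
    using assms by (auto simp: trig_null_def)
  have "(\<integral>z. v z * z powi n \<partial>circle) = (\<integral>z. u z * z powi n \<partial>circle)" for n
    by (rule integral_cong_AE) (use assms(3) in \<open>auto elim!: eventually_mono\<close>)
  moreover have "integrable circle v"
    using assms by (subst integrable_cong_AE[of _ _ u]) (auto simp: trig_null_def elim!: eventually_mono)
  ultimately show ?thesis
    using assms by (simp add: trig_null_def)
qed

text \<open>On the circle \<open>cnj z\<close> is the inverse of z, so a real linear function is a
  combination of z and its inverse, and \<open>trig_null\<close> is stable under multiplication by
  both. Keeping u arbitrary in the induction handles products: the factors are applied one after the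
  other.\<close>

lemma trig_null_times_real_polynomial:
  fixes g :: "complex \<Rightarrow> real"
  assumes "real_polynomial_function g" "trig_null u"
  shows "trig_null (\<lambda>z. u z * of_real (g z))"
  using assms
proof (induction arbitrary: u rule: real_polynomial_function.induct)
  case (linear g)
  have [measurable]: "u \<in> borel_measurable circle"
    using linear by (auto simp: trig_null_def)
  have [measurable]: "g \<in> borel_measurable circle"
    by (intro continuous_measurable_circle linear_continuous_on linear)
  \<comment> \<open>g(z) = a Re z + b Im z, rewritten in terms of z and its conjugate.\<close>
  define a b where "a = complex_of_real (g 1)" and "b = complex_of_real (g \<i>)"
  have g: "complex_of_real (g z) = (a - \<i> * b) / 2 * z + (a + \<i> * b) / 2 * cnj z" for z
  proof -
    have "g z = g (Re z *\<^sub>R 1 + Im z *\<^sub>R \<i>)"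
      by (rule arg_cong[of _ _ g]) (simp add: complex_eq_iff)
    also have "\<dots> = Re z * g 1 + Im z * g \<i>"
      using linear_add[OF bounded_linear.linear[OF linear(1)]]
        linear_scale[OF bounded_linear.linear[OF linear(1)]] by simp
    finally show ?thesis
      by (simp add: a_def b_def complex_eq_iff field_simps)
  qed
  have "trig_null (\<lambda>z. (a - \<i> * b) / 2 * (u z * z powi 1) + (a + \<i> * b) / 2 * (u z * z powi (-1)))"
    by (intro trig_null_add trig_null_scale trig_null_shift linear)
  then show ?case
  proof (rule trig_null_cong)
    show "AE z in circle. (a - \<i> * b) / 2 * (u z * z powi 1) + (a + \<i> * b) / 2 * (u z * z powi (-1)) =
        u z * of_real (g z)"
      using AE_circle_in_sphere
    proof eventually_elim
      case (elim z)
      have "cnj z = z powi (-1)"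
        using cnj_powi_on_circle[OF elim, of 1] by simp
      then show ?case
        unfolding g by (simp add: algebra_simps)
    qed
  qed measurable
next
  case (const c)
  then show ?case
    using trig_null_scale[of u "of_real c"] by (simp add: mult.commute)
next
  case (add f g)
  then show ?case
    using trig_null_add[of "\<lambda>z. u z * of_real (f z)" "\<lambda>z. u z * of_real (g z)"]
    by (simp add: ring_distribs)
next
  case (mult f g)
  from mult.IH(2)[OF mult.IH(1)[OF mult.prems]] show ?case
    by (simp add: mult.assoc)
qed

text \<open>Stone-Weierstrass replaces g by a real polynomial p, uniformly on the circle up to e.
  The integral against p vanishes, and the error is at most e times the integral of |u|.\<close>

lemma trig_null_integral_continuous:
  fixes g :: "complex \<Rightarrow> real"
  assumes u: "trig_null u" and g: "continuous_on UNIV g"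
  shows "(\<integral>z. u z * of_real (g z) \<partial>circle) = 0"
proof -
  have int_u: "integrable circle u"
    using u by (simp add: trig_null_def)
  have int: "integrable circle (\<lambda>z. u z * of_real (h z))" if "continuous_on UNIV h" for h :: "complex \<Rightarrow> real"
    by (intro integrable_times_bounded int_u continuous_Linfinity continuous_intros that)
  have le: "cmod (\<integral>z. u z * of_real (g z) \<partial>circle) \<le> e * (\<integral>z. cmod (u z) \<partial>circle)" if e: "e > 0" for e
  proof -
    obtain p where p: "real_polynomial_function p" "\<And>z. z \<in> sphere 0 1 \<Longrightarrow> \<bar>g z - p z\<bar> < e"
      using Stone_Weierstrass_real_polynomial_function[OF compact_sphere continuous_on_subset[OF g subset_UNIV] e]
      by blast
    have cont_p: "continuous_on UNIV p"
      using continuous_on_polymonial_function p(1) real_polynomial_function_eq by blast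
    have "(\<integral>z. u z * of_real (p z) \<partial>circle) = 0"
      using trig_null_times_real_polynomial[OF p(1) u] unfolding trig_null_def
      by (metis (no_types, lifting) Bochner_Integration.integral_cong mult.right_neutral power_int_0_right)
    then have "(\<integral>z. u z * of_real (g z) \<partial>circle) = (\<integral>z. u z * of_real (g z) - u z * of_real (p z) \<partial>circle)"
      by (simp add: int g cont_p)
    also have "cmod \<dots> \<le> (\<integral>z. e * cmod (u z) \<partial>circle)"
    proof (rule order_trans[OF integral_norm_bound], rule integral_mono_AE)
      show "AE z in circle. cmod (u z * of_real (g z) - u z * of_real (p z)) \<le> e * cmod (u z)"
      proof (rule AE_I2)
        fix z assume "z \<in> space circle"
        then have "\<bar>g z - p z\<bar> \<le> e"
          using p(2)[of z] by (simp add: space_circle)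
        then have "cmod (u z) * \<bar>g z - p z\<bar> \<le> cmod (u z) * e"
          by (intro mult_left_mono) auto
        moreover have "cmod (u z * of_real (g z) - u z * of_real (p z)) = cmod (u z) * \<bar>g z - p z\<bar>"
          by (simp flip: right_diff_distrib of_real_diff add: norm_mult)
        ultimately show "cmod (u z * of_real (g z) - u z * of_real (p z)) \<le> e * cmod (u z)"
          by (simp add: mult.commute)
      qed
    qed (use int g cont_p int_u in auto)
    finally show ?thesis by simp
  qed
  have "cmod (\<integral>z. u z * of_real (g z) \<partial>circle) \<le> 0"
  proof (rule field_le_epsilon)
    fix e :: real assume "e > 0"
    define I where "I = (\<integral>z. cmod (u z) \<partial>circle)"
    have I: "I \<ge> 0" by (simp add: I_def)
    \<comment> \<open>Dividing by I + 1 instead of I covers I = 0.\<close>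
    have "cmod (\<integral>z. u z * of_real (g z) \<partial>circle) \<le> e / (I + 1) * I"
      unfolding I_def[symmetric] by (rule le[folded I_def]) (use I \<open>e > 0\<close> in simp)
    also have "\<dots> \<le> e"
      using I \<open>e > 0\<close> by (simp add: field_simps)
    finally show "cmod (\<integral>z. u z * of_real (g z) \<partial>circle) \<le> 0 + e" by simp
  qed
  then show ?thesis by simp
qed

text \<open>Dynkin's argument from the intersection-stable family of open sets: the indicator of an
  open set is a bounded pointwise limit of continuous functions, and complements and disjoint unions
  follow by linearity and dominated convergence.\<close>

lemma trig_null_integral_borel:
  assumes u: "trig_null u" and B: "B \<in> sets borel"
  shows "(\<integral>z. indicator B z *\<^sub>R u z \<partial>circle) = 0"
proof -
  have int_u: "integrable circle u"
    using u by (simp add: trig_null_def)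
  have [measurable]: "u \<in> borel_measurable circle"
    using int_u by auto
  have ind: "(\<lambda>z. indicator B z :: real) \<in> borel_measurable circle" if "B \<in> sets borel" for B
    using measurable_compose[OF measurable_id_circle borel_measurable_indicator[OF that]] by simp
  have int: "integrable circle (\<lambda>z. indicator B z *\<^sub>R u z)" if "B \<in> sets borel" for B
    by (rule Bochner_Integration.integrable_bound[OF int_u])
       (use ind[OF that] in \<open>auto simp: indicator_def\<close>)
  have total: "(\<integral>z. u z \<partial>circle) = 0"
    using trig_null_integral_continuous[OF u, of "\<lambda>_. 1"] by simp
  have "Int_stable {S :: complex set. open S}" "{S :: complex set. open S} \<subseteq> Pow UNIV"
    by (auto simp: Int_stable_def)
  moreover have "B \<in> sigma_sets UNIV {S. open S}"
    using B by (simp add: sets_borel)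
  ultimately show ?thesis
  proof (induction rule: sigma_sets_induct_disjoint)
    case (basic U)
    then have U: "open U" by simp
    show ?case
    proof (cases "U = UNIV")
      case False
      \<comment> \<open>A truncated multiple of the distance to the complement of U. The whole plane
        is treated apart, because \<open>infdist\<close> to the empty set is 0 by
        convention.\<close>
      define g where "g k z = min 1 (real k * infdist z (- U))" for k z
      have cont_g: "continuous_on UNIV (g k)" for k
        unfolding g_def by (intro continuous_intros)
      have [measurable]: "g k \<in> borel_measurable circle" for k
        by (intro continuous_measurable_circle cont_g)
      have "(\<lambda>k. \<integral>z. u z * of_real (g k z) \<partial>circle) \<longlonglongrightarrow> (\<integral>z. indicator U z *\<^sub>R u z \<partial>circle)"
      proof (rule integral_dominated_convergence[where w = "\<lambda>z. cmod (u z)"])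
        show "AE z in circle. (\<lambda>k. u z * of_real (g k z)) \<longlonglongrightarrow> indicator U z *\<^sub>R u z"
        proof (rule AE_I2)
          fix z
          show "(\<lambda>k. u z * of_real (g k z)) \<longlonglongrightarrow> indicator U z *\<^sub>R u z"
          proof (cases "z \<in> U")
            case True
            then have "infdist z (- U) > 0"
              using in_closed_iff_infdist_zero[of "- U" z] U False infdist_nonneg[of z "- U"]
              by (auto simp: less_le)
            then obtain N :: nat where N: "1 < real N * infdist z (- U)"
              using reals_Archimedean3 by blast
            have "eventually (\<lambda>k. u z * of_real (g k z) = u z) sequentially"
              using eventually_ge_at_top[of N]
            proof eventually_elim
              case (elim k)
              then have "real N * infdist z (- U) \<le> real k * infdist z (- U)"
                by (intro mult_right_mono) (auto simp: infdist_nonneg)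
              then show ?case using N by (simp add: g_def)
            qed
            then show ?thesis
              using True by (simp add: tendsto_eventually)
          next
            case False
            then show ?thesis by (simp add: g_def)
          qed
        qed
        show "AE z in circle. cmod (u z * of_real (g k z)) \<le> cmod (u z)" for k
        proof (rule AE_I2)
          fix z
          have "\<bar>g k z\<bar> \<le> 1"
            by (auto simp: g_def infdist_nonneg)
          then have "cmod (u z) * \<bar>g k z\<bar> \<le> cmod (u z) * 1"
            by (intro mult_left_mono) auto
          then show "cmod (u z * of_real (g k z)) \<le> cmod (u z)"
            by (simp add: norm_mult)
        qed
        show "(\<lambda>z. indicator U z *\<^sub>R u z) \<in> borel_measurable circle"
          using int[of U] U by auto
      qed (use int_u in auto)
      then show ?thesis
        by (simp add: trig_null_integral_continuous[OF u cont_g] LIMSEQ_const_iff)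
    qed (simp add: total)
  next
    case (compl A)
    then have A: "A \<in> sets borel" by (simp add: sets_borel)
    have "(\<integral>z. indicator (UNIV - A) z *\<^sub>R u z \<partial>circle) = (\<integral>z. u z - indicator A z *\<^sub>R u z \<partial>circle)"
      by (intro Bochner_Integration.integral_cong) (auto simp: indicator_def)
    also have "\<dots> = 0"
      using int[OF A] int_u compl total by simp
    finally show ?case .
  next
    case (union A)
    have A: "A i \<in> sets borel" for i
      using union by (auto simp: sets_borel)
    have "(\<lambda>n. \<integral>z. (\<Sum>i<n. indicator (A i) z *\<^sub>R u z) \<partial>circle) \<longlonglongrightarrow> (\<integral>z. indicator (\<Union>i. A i) z *\<^sub>R u z \<partial>circle)"
    proof (rule integral_dominated_convergence[where w = "\<lambda>z. cmod (u z)"])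
      have eq: "(\<Sum>i<n. indicator (A i) z *\<^sub>R u z) = indicator (\<Union>i<n. A i) z *\<^sub>R u z" for n z
        using union(1) by (subst indicator_UN_disjoint)
          (auto simp: disjoint_family_on_def scaleR_sum_left)
      show "AE z in circle. (\<lambda>n. \<Sum>i<n. indicator (A i) z *\<^sub>R u z) \<longlonglongrightarrow> indicator (\<Union>i. A i) z *\<^sub>R u z"
        unfolding eq by (intro AE_I2 tendsto_intros LIMSEQ_indicator_UN)
      show "AE z in circle. cmod (\<Sum>i<n. indicator (A i) z *\<^sub>R u z) \<le> cmod (u z)" for n
        unfolding eq by (auto simp: indicator_def)
      show "(\<lambda>z. indicator (\<Union>i. A i) z *\<^sub>R u z) \<in> borel_measurable circle"
        using int[of "\<Union>i. A i"] A by auto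
      show "(\<lambda>z. \<Sum>i<n. indicator (A i) z *\<^sub>R u z) \<in> borel_measurable circle" for n
        by (intro borel_measurable_sum borel_measurable_integrable int A)
    qed (use int_u in auto)
    moreover have "(\<integral>z. (\<Sum>i<n. indicator (A i) z *\<^sub>R u z) \<partial>circle) = 0" for n
      using int[OF A] union by (subst Bochner_Integration.integral_sum) auto
    ultimately show ?case
      by (simp add: LIMSEQ_const_iff)
  qed auto
qed

text \<open>A set of the completed measure differs from a Borel set only inside a null set. This
  bridges the gap between the Borel sets treated above and the merely Lebesgue measurable set {Re u
  > 0}.\<close>

lemma sets_circle_borel_AE:
  assumes "A \<in> sets circle"
  obtains B where "B \<in> sets borel" "AE z in circle. z \<in> A \<longleftrightarrow> z \<in> B"
proof -
  define M where "M = distr (uniform_measure lborel {0..<2 * pi}) (restrict_space borel (sphere 0 1)) cis"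
  have circle: "circle = completion M"
    by (simp add: circle_def M_def)
  obtain S N N' where A: "A = S \<union> N" "N \<subseteq> N'" "N' \<in> null_sets M" "S \<in> sets M"
    using assms unfolding circle by (rule sets_completionE)
  have "S \<in> sets borel"
    using A(4) by (auto simp: M_def sets_restrict_space)
  moreover have "AE z in circle. z \<notin> N'"
    unfolding circle by (intro AE_completion AE_not_in A)
  then have "AE z in circle. z \<in> A \<longleftrightarrow> z \<in> S"
    by eventually_elim (use A in auto)
  ultimately show ?thesis by (rule that)
qed

text \<open>On a Borel set that agrees with {Re u > 0} almost everywhere, Re u is nonnegative almost
  everywhere and has integral 0, so it vanishes there almost everywhere.\<close>

lemma trig_null_Re_nonpos:
  assumes u: "trig_null u"
  shows "AE z in circle. Re (u z) \<le> 0"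
proof -
  have int_u: "integrable circle u"
    using u by (simp add: trig_null_def)
  have [measurable]: "u \<in> borel_measurable circle"
    using int_u by auto
  have "{z \<in> space circle. Re (u z) > 0} \<in> sets circle"
    by measurable
  then obtain B where B: "B \<in> sets borel" "AE z in circle. z \<in> {z \<in> space circle. Re (u z) > 0} \<longleftrightarrow> z \<in> B"
    by (rule sets_circle_borel_AE)
  have [measurable]: "(\<lambda>z. indicator B z :: real) \<in> borel_measurable circle"
    using measurable_compose[OF measurable_id_circle borel_measurable_indicator[OF B(1)]] by simp
  have int: "integrable circle (\<lambda>z. indicator B z *\<^sub>R u z)"
  proof (rule Bochner_Integration.integrable_bound[OF int_u])
    show "(\<lambda>z. indicator B z *\<^sub>R u z) \<in> borel_measurable circle"
      by measurable
  qed (auto simp: indicator_def)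
  have nonneg: "AE z in circle. 0 \<le> Re (indicator B z *\<^sub>R u z)"
    using B(2) by eventually_elim (auto simp: indicator_def)
  have "(\<integral>z. Re (indicator B z *\<^sub>R u z) \<partial>circle) = 0"
    using trig_null_integral_borel[OF u B(1)] by (subst integral_Re[OF int]) simp
  then have "AE z in circle. Re (indicator B z *\<^sub>R u z) = 0"
    by (subst (asm) integral_nonneg_eq_0_iff_AE) (use integrable_Re[OF int] nonneg in auto)
  with B(2) AE_space[of circle] show ?thesis
    by eventually_elim (auto simp: indicator_def split: if_splits)
qed

lemma trig_null_imp_AE_zero:
  assumes u: "trig_null u"
  shows "AE z in circle. u z = 0"
proof -
  \<comment> \<open>The four choices c = 1, -1, i, -i bound the real and the imaginary part from
    both sides.\<close>
  have "AE z in circle. Re (c * u z) \<le> 0" for c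
    by (intro trig_null_Re_nonpos trig_null_scale u)
  from this[of 1] this[of "-1"] this[of "\<i>"] this[of "-\<i>"] show ?thesis
    by eventually_elim (auto simp: complex_eq_iff)
qed

lemma fourier_coeff_zero_imp:
  assumes "\<And>n. fourier_coeff f n = 0"
  shows "f = 0"
proof -
  interpret prob_space circle by (rule prob_space_circle)
  obtain u where u: "u \<in> square_integrable" "f = L2_class u"
    by (rule L2_class_cases)
  have "(\<integral>z. u z * z powi n \<partial>circle) = 0" for n
    using assms[of "- n"] u by (simp add: fourier_coeff_L2_class)
  moreover have "integrable circle u"
    using integral_cmod_le_norm(1)[OF u(1)] square_integrableD(1)[OF u(1)]
    by (simp add: integrable_norm_iff)
  ultimately have "trig_null u"
    by (simp add: trig_null_def)
  then have "AE z in circle. u z = 0"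
    by (rule trig_null_imp_AE_zero)
  then have "L2_class u = L2_class (\<lambda>_. 0)"
    by (simp add: L2_class_eq_iff u zero_square_integrable)
  then show ?thesis
    using u by (simp add: L2_class_zero)
qed

lemma fourier_coeff_inject:
  assumes "\<And>n. fourier_coeff f n = fourier_coeff g n"
  shows "f = g"
  using fourier_coeff_zero_imp[of "f - g"] assms by (simp add: fourier_coeff_diff)

subsection \<open>Fourier expansions and the projection onto the Hardy space\<close>

lemma norm_sum_monomial:
  assumes "finite A" "inj_on k A"
  shows "(norm (\<Sum>i\<in>A. scaleC (c i) (monomial_L2 (k i))))\<^sup>2 = (\<Sum>i\<in>A. (cmod (c i))\<^sup>2)"
proof -
  have "(norm (\<Sum>i\<in>A. scaleC (c i) (monomial_L2 (k i))))\<^sup>2 =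
      (\<Sum>i\<in>A. (norm (scaleC (c i) (monomial_L2 (k i))))\<^sup>2)"
    using assms
    by (intro norm_sum_orthogonal)
       (auto simp: cinner_scaleC_left cinner_scaleC_right cinner_monomial inj_on_def)
  then show ?thesis by (simp add: norm_scaleC)
qed

text \<open>The partial sum s has the same coefficients as f on the chosen frequencies, so f - s is
  orthogonal to s, and Pythagoras applies.\<close>

lemma bessel_inequality:
  assumes "finite A" "inj_on k A"
  shows "(\<Sum>i\<in>A. (cmod (fourier_coeff f (k i)))\<^sup>2) \<le> (norm f)\<^sup>2"
proof -
  define s where "s = (\<Sum>i\<in>A. scaleC (fourier_coeff f (k i)) (monomial_L2 (k i)))"
  have "cinner (monomial_L2 (k i)) (f - s) = 0" if i: "i \<in> A" for i
  proof -
    have "fourier_coeff s (k i) = (\<Sum>j\<in>A. if j = i then fourier_coeff f (k j) else 0)"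
      unfolding s_def fourier_coeff_sum
      using assms i
      by (intro sum.cong) (auto simp: fourier_coeff_scaleC fourier_coeff_monomial inj_on_def)
    also have "\<dots> = fourier_coeff f (k i)"
      using assms i by simp
    finally have "cinner (f - s) (monomial_L2 (k i)) = 0"
      by (simp add: fourier_coeff_diff flip: fourier_coeff_eq_cinner)
    then show ?thesis by (subst cinner_commute) simp
  qed
  then have "cinner s (f - s) = 0"
    unfolding s_def by (simp add: cinner_sum_left cinner_scaleC_left)
  from norm_add_orthogonal[OF this] have "(norm s)\<^sup>2 \<le> (norm f)\<^sup>2"
    by simp
  then show ?thesis
    unfolding s_def using assms by (simp add: norm_sum_monomial)
qed

text \<open>By Pythagoras the Cauchy condition for the series is that for the squared coefficients,
  which are summable by Bessel; completeness does the rest.\<close>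

lemma summable_fourier:
  fixes k :: "nat \<Rightarrow> int"
  assumes "inj k"
  shows "summable (\<lambda>i. scaleC (fourier_coeff f (k i)) (monomial_L2 (k i)))"
proof -
  have inj: "inj_on k A" for A
    using assms by (rule inj_on_subset) auto
  have "summable (\<lambda>i. (cmod (fourier_coeff f (k i)))\<^sup>2)"
    by (rule bounded_imp_summable[where B = "(norm f)\<^sup>2"])
       (auto intro!: bessel_inequality inj)
  then have sc: "\<forall>e>0. \<exists>N. \<forall>m\<ge>N. \<forall>n. norm (\<Sum>i\<in>{m..<n}. (cmod (fourier_coeff f (k i)))\<^sup>2) < e"
    by (simp only: summable_Cauchy)
  show ?thesis
    unfolding summable_Cauchy
  proof (intro allI impI)
    fix e :: real assume e: "e > 0"
    then obtain N where N: "\<And>m n. m \<ge> N \<Longrightarrow>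
        norm (\<Sum>i\<in>{m..<n}. (cmod (fourier_coeff f (k i)))\<^sup>2) < e\<^sup>2"
      using sc by (meson zero_less_power)
    have "norm (\<Sum>i\<in>{m..<n}. scaleC (fourier_coeff f (k i)) (monomial_L2 (k i))) < e"
      if "m \<ge> N" for m n
    proof (rule power2_less_imp_less)
      show "(norm (\<Sum>i\<in>{m..<n}. scaleC (fourier_coeff f (k i)) (monomial_L2 (k i))))\<^sup>2 < e\<^sup>2"
        using N[OF that, of n] by (simp add: norm_sum_monomial inj)
    qed (use e in simp)
    then show "\<exists>N. \<forall>m\<ge>N. \<forall>n. norm (\<Sum>i\<in>{m..<n}. scaleC (fourier_coeff f (k i)) (monomial_L2 (k i))) < e"
      by blast
  qed
qed

text \<open>The sequence \<open>k\<close> enumerates the frequencies to be kept: \<open>int\<close>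
  yields the projection onto \<open>H2\<close>, and \<open>int_decode\<close>, a bijection onto the
  integers, yields the full expansion. The coefficients of the sum follow from their
  continuity.\<close>

lemma fourier_part:
  fixes k :: "nat \<Rightarrow> int"
  assumes "inj k"
  obtains g where "(\<lambda>i. scaleC (fourier_coeff f (k i)) (monomial_L2 (k i))) sums g"
    and "\<And>n. fourier_coeff g n = (if n \<in> range k then fourier_coeff f n else 0)"
proof -
  obtain g where g: "(\<lambda>i. scaleC (fourier_coeff f (k i)) (monomial_L2 (k i))) sums g"
    using summable_fourier[OF assms, of f] by (auto simp: summable_def)
  have "fourier_coeff g n = (if n \<in> range k then fourier_coeff f n else 0)" for n
  proof -
    have "(\<lambda>i. fourier_coeff (scaleC (fourier_coeff f (k i)) (monomial_L2 (k i))) n) sums fourier_coeff g n"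
      by (rule bounded_linear.sums[OF bounded_linear_fourier_coeff g])
    then have s: "(\<lambda>i. if k i = n then fourier_coeff f n else 0) sums fourier_coeff g n"
      by (rule back_subst[of "\<lambda>h. h sums _"])
         (auto simp: fourier_coeff_scaleC fourier_coeff_monomial)
    show ?thesis
    proof (cases "n \<in> range k")
      case True
      then obtain j where j: "n = k j" by auto
      have "(\<lambda>i. if k i = n then fourier_coeff f n else 0) = (\<lambda>i. if i = j then fourier_coeff f n else 0)"
        using assms by (auto simp: j fun_eq_iff dest: injD)
      from sums_unique2[OF s[unfolded this] sums_single[of j "\<lambda>_. fourier_coeff f n"]] True
      show ?thesis by simp
    next
      case False
      then have "(\<lambda>i. if k i = n then fourier_coeff f n else 0) = (\<lambda>i. 0)"
        by (intro ext) auto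
      from sums_unique2[OF s[unfolded this] sums_zero] False show ?thesis by simp
    qed
  qed
  with g show ?thesis by (rule that)
qed

lemma fourier_expansion:
  fixes k :: "nat \<Rightarrow> int"
  assumes "inj k" "\<And>n. n \<notin> range k \<Longrightarrow> fourier_coeff f n = 0"
  shows "(\<lambda>i. scaleC (fourier_coeff f (k i)) (monomial_L2 (k i))) sums f"
proof -
  obtain g where g: "(\<lambda>i. scaleC (fourier_coeff f (k i)) (monomial_L2 (k i))) sums g"
    "\<And>n. fourier_coeff g n = (if n \<in> range k then fourier_coeff f n else 0)"
    using fourier_part[OF assms(1)] by blast
  have "g = f"
    by (rule fourier_coeff_inject) (use assms(2) g(2) in auto)
  then show ?thesis using g by simp
qed

lemma H2_fourier_expansion:
  assumes "f \<in> H2"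
  shows "(\<lambda>i. scaleC (fourier_coeff f (int i)) (monomial_L2 (int i))) sums f"
proof (rule fourier_expansion)
  fix n assume "n \<notin> range int"
  then have "n < 0"
    by (metis nonneg_int_cases not_le rangeI)
  then show "fourier_coeff f n = 0"
    using assms by (simp add: H2_def)
qed auto

section \<open>The Hardy space and its orthogonal projection\<close>

lemma H2_iff: "f \<in> H2 \<longleftrightarrow> (\<forall>n<0. fourier_coeff f n = 0)"
  by (simp add: H2_def)

lemma csubspace_H2: "csubspace H2"
  by (auto simp: csubspace_def H2_def fourier_coeff_zero fourier_coeff_add fourier_coeff_scaleC)

lemma csubspace_diff: "csubspace M \<Longrightarrow> x \<in> M \<Longrightarrow> y \<in> M \<Longrightarrow> x - y \<in> M"
  unfolding csubspace_def minus_L2_def uminus_L2_def by blast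

lemma csubspace_sum:
  assumes "csubspace M" "\<And>i. i \<in> A \<Longrightarrow> f i \<in> M"
  shows "(\<Sum>i\<in>A. f i) \<in> M"
  using assms(2)
  by (induction A rule: infinite_finite_induct) (use assms(1) in \<open>auto simp: csubspace_def\<close>)

lemma csubspace_scaleC: "csubspace M \<Longrightarrow> x \<in> M \<Longrightarrow> scaleC c x \<in> M"
  by (simp add: csubspace_def)

lemma closed_H2: "closed H2"
proof -
  have "closed {f. fourier_coeff f n = 0}" for n
    by (intro closed_Collect_eq linear_continuous_on bounded_linear_fourier_coeff continuous_on_const)
  then have "closed (\<Inter>n\<in>{..<0}. {f. fourier_coeff f n = 0})"
    by blast
  also have "(\<Inter>n\<in>{..<0}. {f. fourier_coeff f n = 0}) = H2"
    by (auto simp: H2_def)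
  finally show ?thesis .
qed

lemma sums_in_closed_csubspace:
  assumes "csubspace M" "closed M" "f sums s" "\<And>i. f i \<in> M"
  shows "s \<in> M"
  using assms(2) _ assms(3)[unfolded sums_def]
  by (rule closed_sequentially) (intro csubspace_sum assms)

lemma monomial_in_H2: "monomial_L2 n \<in> H2 \<longleftrightarrow> 0 \<le> n"
  by (auto simp: H2_def fourier_coeff_monomial not_less)

lemma cinner_H2_eq_zero:
  assumes "\<And>n. 0 \<le> n \<Longrightarrow> fourier_coeff g n = 0" "h \<in> H2"
  shows "cinner g h = 0"
proof -
  have "(\<lambda>i. cinner g (scaleC (fourier_coeff h (int i)) (monomial_L2 (int i)))) sums cinner g h"
    by (rule bounded_linear.sums[OF bounded_linear_cinner_right H2_fourier_expansion[OF assms(2)]])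
  then have "(\<lambda>i. 0) sums cinner g h"
    using assms(1) by (simp add: cinner_scaleC_right flip: fourier_coeff_eq_cinner)
  then show ?thesis
    by (rule sums_unique2) (rule sums_zero)
qed

text \<open>The part of f with nonnegative frequencies satisfies the description in
  \<open>orth_proj\<close>. Testing the description against monomials in \<open>H2\<close> forces
  the coefficients, so it is the only candidate. All further properties of the projection are read
  off from this formula.\<close>

lemma fourier_coeff_orth_proj:
  "fourier_coeff (orth_proj H2 f) n = (if 0 \<le> n then fourier_coeff f n else 0)"
proof -
  have range: "m \<in> range int \<longleftrightarrow> 0 \<le> m" for m
    by (auto intro: range_eqI[of _ _ "nat m"])
  obtain g where g: "\<And>n. fourier_coeff g n = (if 0 \<le> n then fourier_coeff f n else 0)"
    using fourier_part[of int f] unfolding range by auto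
  have "orth_proj H2 f = g"
    unfolding orth_proj_def
  proof (rule the_equality)
    show "g \<in> H2 \<and> (\<forall>h\<in>H2. cinner (f - g) h = 0)"
      using g by (auto simp: H2_def fourier_coeff_diff intro!: cinner_H2_eq_zero)
    fix g' assume g': "g' \<in> H2 \<and> (\<forall>h\<in>H2. cinner (f - g') h = 0)"
    show "g' = g"
    proof (rule fourier_coeff_inject)
      fix n
      show "fourier_coeff g' n = fourier_coeff g n"
      proof (cases "0 \<le> n")
        case True
        then have "fourier_coeff (f - g') n = 0"
          using g' monomial_in_H2[of n] by (auto simp: fourier_coeff_eq_cinner)
        then show ?thesis
          using g True by (simp add: fourier_coeff_diff)
      qed (use g' g in \<open>auto simp: H2_def\<close>)
    qed
  qed
  then show ?thesis by (simp add: g)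
qed

lemma orth_proj_in_H2: "orth_proj H2 f \<in> H2"
  unfolding H2_iff by (simp add: fourier_coeff_orth_proj)

lemma orth_proj_H2_ident: "f \<in> H2 \<Longrightarrow> orth_proj H2 f = f"
  by (rule fourier_coeff_inject) (auto simp: fourier_coeff_orth_proj H2_iff)

lemma orth_proj_H2_add: "orth_proj H2 (f + g) = orth_proj H2 f + orth_proj H2 g"
  by (rule fourier_coeff_inject) (auto simp: fourier_coeff_orth_proj fourier_coeff_add)

lemma orth_proj_H2_scaleC: "orth_proj H2 (scaleC c f) = scaleC c (orth_proj H2 f)"
  by (rule fourier_coeff_inject) (auto simp: fourier_coeff_orth_proj fourier_coeff_scaleC)

lemma norm_orth_proj_H2:
  "(norm f)\<^sup>2 = (norm (orth_proj H2 f))\<^sup>2 + (norm (f - orth_proj H2 f))\<^sup>2"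
proof -
  have "cinner (f - orth_proj H2 f) (orth_proj H2 f) = 0"
    by (rule cinner_H2_eq_zero) (auto simp: fourier_coeff_diff fourier_coeff_orth_proj orth_proj_in_H2)
  from norm_add_orthogonal[OF this] show ?thesis by (simp add: add.commute)
qed

lemma norm_orth_proj_H2_le: "norm (orth_proj H2 f) \<le> norm f"
  by (rule power2_le_imp_le) (use norm_orth_proj_H2[of f] in simp_all)

lemma norm_diff_orth_proj_H2_le: "norm (f - orth_proj H2 f) \<le> norm f"
  by (rule power2_le_imp_le) (use norm_orth_proj_H2[of f] in simp_all)

lemma bounded_linear_orth_proj_H2: "bounded_linear (orth_proj H2)"
  by (rule bounded_linear_intro[where K = 1])
     (simp_all add: orth_proj_H2_add orth_proj_H2_scaleC norm_orth_proj_H2_le flip: scaleC_of_real)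

subsection \<open>Multiplication operators\<close>

lemma multiplication_add:
  assumes "\<phi> \<in> Linfinity"
  shows "multiplication \<phi> (f + g) = multiplication \<phi> f + multiplication \<phi> g"
proof -
  obtain u v where "u \<in> square_integrable" "f = L2_class u" "v \<in> square_integrable" "g = L2_class v"
    by (metis L2_class_cases)
  then show ?thesis
    using assms by (simp add: L2_class_add multiplication_L2_class add_square_integrable
        mult_square_integrable ring_distribs)
qed

lemma multiplication_scaleC:
  assumes "\<phi> \<in> Linfinity"
  shows "multiplication \<phi> (scaleC c f) = scaleC c (multiplication \<phi> f)"
proof -
  obtain u where "u \<in> square_integrable" "f = L2_class u"
    by (metis L2_class_cases)
  then show ?thesis
    using assms by (simp add: L2_class_scaleC multiplication_L2_class scale_square_integrable
        mult_square_integrable mult.left_commute)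
qed

lemma multiplication_multiplication:
  assumes "\<phi> \<in> Linfinity" "\<psi> \<in> Linfinity"
  shows "multiplication \<phi> (multiplication \<psi> f) = multiplication (\<lambda>z. \<phi> z * \<psi> z) f"
proof -
  obtain u where "u \<in> square_integrable" "f = L2_class u"
    by (metis L2_class_cases)
  then show ?thesis
    using assms by (simp add: multiplication_L2_class mult_square_integrable mult_Linfinity mult.assoc)
qed

lemma multiplication_commute:
  assumes "\<phi> \<in> Linfinity" "\<psi> \<in> Linfinity"
  shows "multiplication \<phi> (multiplication \<psi> f) = multiplication \<psi> (multiplication \<phi> f)"
  using assms by (simp add: multiplication_multiplication mult.commute)

lemma norm_multiplication_le:
  assumes "\<phi> \<in> Linfinity" "AE z in circle. cmod (\<phi> z) \<le> C" "0 \<le> C"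
  shows "norm (multiplication \<phi> f) \<le> C * norm f"
proof -
  obtain u where u: "u \<in> square_integrable" "f = L2_class u"
    by (metis L2_class_cases)
  have "norm (L2_class (\<lambda>z. \<phi> z * u z)) \<le> norm (L2_class (\<lambda>z. of_real C * u z))"
  proof (rule norm_L2_class_mono)
    show "AE z in circle. cmod (\<phi> z * u z) \<le> cmod (of_real C * u z)"
      using assms(2) by eventually_elim (auto simp: norm_mult assms(3) intro!: mult_right_mono)
  qed (intro mult_square_integrable scale_square_integrable assms u)+
  also have "\<dots> = C * norm f"
    using u assms(3) by (simp add: L2_class_scaleC[symmetric] norm_scaleC)
  finally show ?thesis
    using assms u by (simp add: multiplication_L2_class)
qed

lemma Linfinity_bound:
  assumes "\<phi> \<in> Linfinity"
  obtains C where "0 \<le> C" "AE z in circle. cmod (\<phi> z) \<le> C"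
proof -
  obtain C where "AE z in circle. cmod (\<phi> z) \<le> C"
    using assms by (auto simp: Linfinity_def)
  then have "AE z in circle. cmod (\<phi> z) \<le> max 0 C"
    by eventually_elim auto
  then show ?thesis using that[of "max 0 C"] by simp
qed

lemma bounded_linear_multiplication:
  assumes "\<phi> \<in> Linfinity"
  shows "bounded_linear (multiplication \<phi>)"
proof -
  obtain C where "0 \<le> C" "AE z in circle. cmod (\<phi> z) \<le> C"
    using Linfinity_bound[OF assms] .
  then show ?thesis
    using assms
    by (intro bounded_linear_intro[where K = C])
       (simp_all add: multiplication_add multiplication_scaleC norm_multiplication_le mult.commute[of _ C]
          flip: scaleC_of_real)
qed

text \<open>Multiplication by q convolves the coefficients with those of q. For negative n this
  turns membership of the product in \<open>H2\<close> into a linear recurrence.\<close>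

lemma fourier_coeff_poly_mult:
  "fourier_coeff (multiplication (poly q) f) n =
    (\<Sum>j\<le>degree q. coeff q j * fourier_coeff f (n - int j))"
proof -
  interpret prob_space circle by (rule prob_space_circle)
  obtain u where u: "u \<in> square_integrable" "f = L2_class u"
    by (metis L2_class_cases)
  have int_u: "integrable circle u"
    using integral_cmod_le_norm(1)[OF u(1)] square_integrableD(1)[OF u(1)]
    by (simp add: integrable_norm_iff)
  note [measurable] = square_integrableD(1)[OF u(1)]
  have [measurable]: "poly q \<in> borel_measurable circle"
    using poly_Linfinity by (auto simp: Linfinity_def)
  have "fourier_coeff (multiplication (poly q) f) n = (\<integral>z. poly q z * u z * z powi (- n) \<partial>circle)"
    using u by (simp add: multiplication_L2_class poly_Linfinity fourier_coeff_L2_class mult_square_integrable)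
  also have "\<dots> = (\<integral>z. (\<Sum>j\<le>degree q. coeff q j * (u z * z powi (- (n - int j)))) \<partial>circle)"
  proof (rule integral_cong_AE)
    show "AE z in circle. poly q z * u z * z powi (- n) =
        (\<Sum>j\<le>degree q. coeff q j * (u z * z powi (- (n - int j))))"
      using AE_circle_neq[of 0]
    proof eventually_elim
      case (elim z)
      then have "z powi (- (n - int j)) = z ^ j * z powi (- n)" for j
        using power_int_add[of z "int j" "- n"] by simp
      then show ?case
        by (simp add: poly_altdef sum_distrib_left sum_distrib_right mult_ac)
    qed
  qed measurable
  also have "\<dots> = (\<Sum>j\<le>degree q. coeff q j * (\<integral>z. u z * z powi (- (n - int j)) \<partial>circle))"
    using integrable_times_bounded[OF int_u powi_Linfinity]
    by (subst Bochner_Integration.integral_sum) auto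
  finally show ?thesis
    using u by (simp add: fourier_coeff_L2_class)
qed

section \<open>Shifts and analytic symbols\<close>

definition shift_L2 :: "int \<Rightarrow> L2 \<Rightarrow> L2" where
  "shift_L2 m = multiplication (\<lambda>z. z powi m)"

lemma fourier_coeff_shift: "fourier_coeff (shift_L2 m f) n = fourier_coeff f (n - m)"
proof -
  obtain u where u: "u \<in> square_integrable" "f = L2_class u"
    by (metis L2_class_cases)
  note [measurable] = square_integrableD(1)[OF u(1)]
  have "(\<integral>z. z powi m * u z * z powi (- n) \<partial>circle) = (\<integral>z. u z * z powi (- (n - m)) \<partial>circle)"
  proof (rule integral_cong_AE)
    show "AE z in circle. z powi m * u z * z powi (- n) = u z * z powi (- (n - m))"
      using AE_circle_neq[of 0]
    proof eventually_elim
      case (elim z)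
      then show ?case
        using power_int_add[of z m "- n"] by (simp add: mult_ac)
    qed
  qed auto
  then show ?thesis
    using u by (simp add: shift_L2_def multiplication_L2_class powi_Linfinity fourier_coeff_L2_class
        mult_square_integrable)
qed

lemma norm_shift [simp]: "norm (shift_L2 m f) = norm f"
proof (rule antisym)
  have le: "norm (shift_L2 m f) \<le> norm f" for m f
  proof -
    have "AE z in circle. cmod (z powi m) \<le> 1"
      using AE_circle_in_sphere by eventually_elim (simp add: norm_power_int)
    from norm_multiplication_le[OF powi_Linfinity this] show ?thesis
      by (simp add: shift_L2_def)
  qed
  show "norm (shift_L2 m f) \<le> norm f"
    by (rule le)
  have "shift_L2 (- m) (shift_L2 m f) = f"
    by (rule fourier_coeff_inject) (simp add: fourier_coeff_shift)
  then show "norm f \<le> norm (shift_L2 m f)"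
    using le[of "- m" "shift_L2 m f"] by simp
qed

lemma multiplication_monomial:
  assumes "\<phi> \<in> Linfinity"
  shows "multiplication \<phi> (monomial_L2 n) = shift_L2 n (L2_class \<phi>)"
  using assms unfolding monomial_L2_def shift_L2_def
  by (simp add: multiplication_L2_class powi_square_integrable powi_Linfinity
      Linfinity_square_integrable mult.commute)

text \<open>Expand f in monomials: \<phi> times a monomial of nonnegative degree is a forward shift
  of \<phi>, hence in \<open>H2\<close>, and \<open>H2\<close> is closed.\<close>

lemma multiplication_in_H2:
  assumes "\<phi> \<in> Linfinity" "L2_class \<phi> \<in> H2" "f \<in> H2"
  shows "multiplication \<phi> f \<in> H2"
proof -
  have s: "(\<lambda>i. multiplication \<phi> (scaleC (fourier_coeff f (int i)) (monomial_L2 (int i)))) sums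
      multiplication \<phi> f"
    by (rule bounded_linear.sums[OF bounded_linear_multiplication[OF assms(1)]
        H2_fourier_expansion[OF assms(3)]])
  show ?thesis
  proof (rule sums_in_closed_csubspace[OF csubspace_H2 closed_H2 s])
    fix i
    have "multiplication \<phi> (monomial_L2 (int i)) \<in> H2"
      using assms(2) by (simp add: multiplication_monomial[OF assms(1)] H2_iff fourier_coeff_shift)
    then show "multiplication \<phi> (scaleC (fourier_coeff f (int i)) (monomial_L2 (int i))) \<in> H2"
      using assms(1) by (simp add: multiplication_scaleC csubspace_scaleC csubspace_H2)
  qed
qed

section \<open>Polynomials as elements of the Hardy space\<close>

definition poly_L2 :: "complex poly \<Rightarrow> L2" where
  "poly_L2 p = L2_class (poly p)"

lemma poly_square_integrable: "poly p \<in> square_integrable" for p :: "complex poly"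
  by (intro Linfinity_square_integrable poly_Linfinity)

text \<open>Exchanges symbol and argument: a polynomial vector acted on by \<phi> becomes a
  polynomial multiplier acting on \<phi>, the form from which rationality is deduced.\<close>

lemma multiplication_poly_L2:
  "\<phi> \<in> Linfinity \<Longrightarrow> multiplication \<phi> (poly_L2 p) = multiplication (poly p) (L2_class \<phi>)"
  by (simp add: poly_L2_def multiplication_L2_class poly_square_integrable poly_Linfinity
      Linfinity_square_integrable mult.commute)

lemma fourier_coeff_poly_L2:
  "fourier_coeff (poly_L2 p) n = (if 0 \<le> n then coeff p (nat n) else 0)"
proof -
  have "L2_class (\<lambda>_. 1) = monomial_L2 0"
    by (simp add: monomial_L2_def)
  moreover have "poly_L2 p = multiplication (poly p) (L2_class (\<lambda>_. 1))"
    using powi_square_integrable[of 0] by (simp add: poly_L2_def multiplication_L2_class poly_Linfinity)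
  ultimately have "fourier_coeff (poly_L2 p) n = (\<Sum>j\<le>degree p. coeff p j * (if int j = n then 1 else 0))"
    by (auto simp: fourier_coeff_poly_mult fourier_coeff_monomial intro!: sum.cong)
  also have "\<dots> = (\<Sum>j\<le>degree p. if 0 \<le> n \<and> j = nat n then coeff p (nat n) else 0)"
    by (intro sum.cong) auto
  also have "\<dots> = (if 0 \<le> n then coeff p (nat n) else 0)"
    by (auto simp: coeff_eq_0)
  finally show ?thesis .
qed

lemma poly_L2_in_H2: "poly_L2 p \<in> H2"
  by (simp add: H2_def fourier_coeff_poly_L2)

lemma poly_L2_eq_0_iff: "poly_L2 p = 0 \<longleftrightarrow> p = 0"
proof
  assume "poly_L2 p = 0"
  then have "coeff p n = 0" for n
    using fourier_coeff_poly_L2[of p "int n"] by (simp add: fourier_coeff_zero)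
  then show "p = 0" by (simp add: poly_eq_iff)
qed (simp add: poly_L2_def poly_0[abs_def] L2_class_zero)

lemma poly_L2_add: "poly_L2 (p + q) = poly_L2 p + poly_L2 q"
  by (rule fourier_coeff_inject) (simp add: fourier_coeff_add fourier_coeff_poly_L2)

lemma poly_L2_smult: "poly_L2 (smult c p) = scaleC c (poly_L2 p)"
  by (rule fourier_coeff_inject) (simp add: fourier_coeff_scaleC fourier_coeff_poly_L2)

lemma poly_L2_sum: "poly_L2 (\<Sum>i\<in>A. p i) = (\<Sum>i\<in>A. poly_L2 (p i))"
  by (induction A rule: infinite_finite_induct) (auto simp: poly_L2_add poly_L2_eq_0_iff)

lemma poly_L2_monom_mult:
  "poly_L2 (monom 1 m * p) = shift_L2 (int m) (poly_L2 p)"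
  by (rule fourier_coeff_inject)
     (auto simp: fourier_coeff_shift fourier_coeff_poly_L2 coeff_monom_mult nat_diff_distrib)

subsection \<open>Sufficiency\<close>

text \<open>Gaussian elimination, one equation at a time. The unknowns are indexed by an arbitrary
  finite set so that the pivot can be removed from it.\<close>

lemma homogeneous_system_nontrivial_solution:
  fixes F :: "nat \<Rightarrow> 'b \<Rightarrow> 'a :: field"
  assumes "finite A" "k < card A"
  shows "\<exists>c. (\<exists>j\<in>A. c j \<noteq> 0) \<and> (\<forall>i<k. (\<Sum>j\<in>A. c j * F i j) = 0)"
  using assms
proof (induction k arbitrary: A F)
  case 0
  then have "A \<noteq> {}" by auto
  then show ?case by (intro exI[of _ "\<lambda>_. 1"]) auto
next
  case (Suc k)
  show ?case
  proof (cases "\<forall>j\<in>A. F k j = 0")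
    case True
    obtain c where "\<exists>j\<in>A. c j \<noteq> 0" "\<forall>i<k. (\<Sum>j\<in>A. c j * F i j) = 0"
      using Suc.IH[of A F] Suc.prems by auto
    then show ?thesis
      using True by (intro exI[of _ c]) (auto simp: less_Suc_eq)
  next
    case False
    then obtain p where p: "p \<in> A" "F k p \<noteq> 0" by auto
    have fin: "finite (A - {p})"
      using Suc.prems by simp
    moreover have "k < card (A - {p})"
      using Suc.prems p by simp
    ultimately obtain c where c: "\<exists>j\<in>A - {p}. c j \<noteq> 0"
      "\<And>i. i < k \<Longrightarrow> (\<Sum>j\<in>A - {p}. c j * (F i j - F i p * F k j / F k p)) = 0"
      using Suc.IH[of "A - {p}" "\<lambda>i j. F i j - F i p * F k j / F k p"] by auto
    \<comment> \<open>The k-th equation is solved for the pivot unknown; the system given to the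
      induction hypothesis is the result of this substitution.\<close>
    define c' where "c' = c(p := - (\<Sum>j\<in>A - {p}. c j * F k j) / F k p)"
    have sum: "(\<Sum>j\<in>A. c' j * F i j) =
        (\<Sum>j\<in>A - {p}. c j * F i j) - (\<Sum>j\<in>A - {p}. c j * F k j) / F k p * F i p" for i
      using Suc.prems p by (subst sum.remove[of A p]) (auto simp: c'_def)
    have "(\<Sum>j\<in>A. c' j * F i j) = 0" if "i < Suc k" for i
    proof (cases "i = k")
      case True
      then show ?thesis using p by (simp add: sum)
    next
      case False
      then have "(\<Sum>j\<in>A - {p}. c j * (F i j - F i p * F k j / F k p)) = 0"
        using that by (intro c(2)) auto
      then show ?thesis
        unfolding sum
        by (simp add: right_diff_distrib sum_subtractf sum_distrib_left sum_distrib_right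
              sum_divide_distrib mult_ac)
    qed
    moreover have "\<exists>j\<in>A. c' j \<noteq> 0"
      using c(1) by (auto simp: c'_def)
    ultimately show ?thesis by blast
  qed
qed

section \<open>Orthonormal families and subspaces of finite dimension\<close>

lemma csubspace_normalize:
  assumes "csubspace M" "x \<in> M" "x \<noteq> 0"
  shows "inverse (norm x) *\<^sub>R x \<in> M" "norm (inverse (norm x) *\<^sub>R x) = 1"
  using csubspace_scaleC[OF assms(1,2), of "of_real (inverse (norm x))"] assms(3)
  unfolding scaleC_of_real by simp_all

definition orthonormal_in :: "L2 set \<Rightarrow> nat \<Rightarrow> (nat \<Rightarrow> L2) \<Rightarrow> bool" where
  "orthonormal_in M n v \<longleftrightarrow> (\<forall>i<n. v i \<in> M) \<and>
     (\<forall>i<n. \<forall>j<n. cinner (v i) (v j) = (if i = j then 1 else 0))"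

lemma norm_eq_one_iff_cinner: "norm f = 1 \<longleftrightarrow> cinner f f = 1"
proof -
  have "cinner f f = 1 \<longleftrightarrow> complex_of_real ((norm f)\<^sup>2) = of_real 1"
    by (simp only: cinner_self of_real_1)
  also have "\<dots> \<longleftrightarrow> (norm f)\<^sup>2 = 1"
    by (simp only: of_real_eq_iff)
  also have "\<dots> \<longleftrightarrow> norm f = 1"
    using power2_eq_iff_nonneg[of "norm f" 1] by simp
  finally show ?thesis by simp
qed

text \<open>Gram-Schmidt: while the family does not span M, the normalized remainder of some x in M
  extends it. The dichotomy takes the place of a notion of dimension.\<close>

lemma orthonormal_in_extend_or_span:
  assumes M: "csubspace M"
  shows "(\<exists>v. orthonormal_in M N v) \<or>
    (\<exists>n v. orthonormal_in M n v \<and> (\<forall>x\<in>M. x = (\<Sum>i<n. scaleC (cinner x (v i)) (v i))))"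
proof (induction N)
  case 0
  show ?case by (auto simp: orthonormal_in_def)
next
  case (Suc N)
  show ?case
  proof (rule disjCI)
    assume *: "\<nexists>n v. orthonormal_in M n v \<and> (\<forall>x\<in>M. x = (\<Sum>i<n. scaleC (cinner x (v i)) (v i)))"
    with Suc obtain v where v: "orthonormal_in M N v"
      by blast
    with * obtain x where x: "x \<in> M" "x \<noteq> (\<Sum>i<N. scaleC (cinner x (v i)) (v i))"
      by blast
    define w where "w = x - (\<Sum>i<N. scaleC (cinner x (v i)) (v i))"
    have w: "w \<in> M" "w \<noteq> 0"
      using x v unfolding w_def orthonormal_in_def
      by (auto intro!: csubspace_diff csubspace_sum csubspace_scaleC M)
    have wv: "cinner w (v j) = 0" if "j < N" for j
    proof -
      have "(\<Sum>i<N. cinner (scaleC (cinner x (v i)) (v i)) (v j)) =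
          (\<Sum>i<N. if i = j then cinner x (v j) else 0)"
        using v that by (intro sum.cong) (auto simp: cinner_scaleC_left orthonormal_in_def)
      then show ?thesis
        using that by (simp add: w_def cinner_diff_left cinner_sum_left)
    qed
    then have vw: "cinner (v j) w = 0" if "j < N" for j
      using that by (subst cinner_commute) simp
    define e where "e = scaleC (of_real (inverse (norm w))) w"
    have e: "e \<in> M" "cinner e e = 1"
      using w by (auto simp: e_def csubspace_scaleC M norm_scaleC simp flip: norm_eq_one_iff_cinner
          simp del: of_real_inverse)
    have "orthonormal_in M (Suc N) (v(N := e))"
      using v e wv vw
      by (auto simp: orthonormal_in_def less_Suc_eq e_def cinner_scaleC_left cinner_scaleC_right)
    then show "\<exists>v. orthonormal_in M (Suc N) v"
      by blast
  qed
qed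

lemma norm_sum_orthonormal_in:
  assumes "orthonormal_in M n v"
  shows "(norm (\<Sum>i<n. scaleC (c i) (v i)))\<^sup>2 = (\<Sum>i<n. (cmod (c i))\<^sup>2)"
proof -
  have "(norm (\<Sum>i<n. scaleC (c i) (v i)))\<^sup>2 = (\<Sum>i<n. (norm (scaleC (c i) (v i)))\<^sup>2)"
    using assms
    by (intro norm_sum_orthogonal)
       (auto simp: cinner_scaleC_left cinner_scaleC_right orthonormal_in_def)
  also have "\<dots> = (\<Sum>i<n. (cmod (c i))\<^sup>2)"
    using assms by (intro sum.cong) (auto simp: norm_scaleC orthonormal_in_def
        dest!: spec simp flip: norm_eq_one_iff_cinner)
  finally show ?thesis .
qed

lemma norm_attaining_onI:
  assumes "x \<in> M" "norm x = 1" "\<And>y. y \<in> M \<Longrightarrow> norm (T y) \<le> norm (T x) * norm y"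
  shows "norm_attaining_on M T"
proof -
  have "onorm_on M T = norm (T x)"
    unfolding onorm_on_def
  proof (rule cSup_eq_maximum)
    show "norm (T x) \<in> (\<lambda>x. norm (T x) / norm x) ` M"
      using assms by (intro image_eqI[of _ _ x]) auto
    fix r assume "r \<in> (\<lambda>x. norm (T x) / norm x) ` M"
    then obtain y where y: "y \<in> M" "r = norm (T y) / norm y" by auto
    \<comment> \<open>\<open>onorm_on\<close> also ranges over y = 0, where the quotient is 0 by the
      convention for division.\<close>
    then show "r \<le> norm (T x)"
      using assms(3)[of y] by (cases "y = 0") (auto simp: divide_le_eq)
  qed
  then show ?thesis
    using assms by (auto simp: norm_attaining_on_def)
qed

text \<open>Each further vector gives the image of a compact product with the closed unit disc under
  a continuous map.\<close>

lemma compact_bounded_combinations: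
  fixes v :: "nat \<Rightarrow> L2"
  shows "compact {(\<Sum>i<n. scaleC (a i) (v i)) |a. \<forall>i<n. cmod (a i) \<le> 1}"
proof (induction n)
  case 0
  show ?case by simp
next
  case (Suc n)
  let ?K = "{(\<Sum>i<n. scaleC (a i) (v i)) |a. \<forall>i<n. cmod (a i) \<le> 1}"
  have cont: "continuous_on (?K \<times> cball 0 1) (\<lambda>(x, c). x + scaleC c (v n))"
  proof -
    have "bounded_linear (\<lambda>c. scaleC c (v n))"
      by (rule bounded_linear_intro[where K = "norm (v n)"])
         (auto simp: scaleC_add_left norm_scaleC scaleR_conv_of_real simp flip: scaleC_of_real)
    then show ?thesis
      unfolding case_prod_unfold
      by (intro continuous_intros bounded_linear.continuous_on[of "\<lambda>c. scaleC c (v n)"])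
  qed
  have "{(\<Sum>i<Suc n. scaleC (a i) (v i)) |a. \<forall>i<Suc n. cmod (a i) \<le> 1} =
      (\<lambda>(x, c). x + scaleC c (v n)) ` (?K \<times> cball 0 1)" (is "?L = ?R")
  proof
    show "?L \<subseteq> ?R"
    proof
      fix x assume "x \<in> ?L"
      then obtain a where "x = (\<Sum>i<n. scaleC (a i) (v i)) + scaleC (a n) (v n)" "\<forall>i<Suc n. cmod (a i) \<le> 1"
        by auto
      then show "x \<in> ?R"
        by (intro image_eqI[of _ _ "(\<Sum>i<n. scaleC (a i) (v i), a n)"]) auto
    qed
    show "?R \<subseteq> ?L"
    proof clarsimp
      fix c a assume "cmod c \<le> 1" "\<forall>i<n. cmod (a i) \<le> 1"
      then show "\<exists>a'. (\<Sum>i<n. scaleC (a i) (v i)) + scaleC c (v n) =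
          (\<Sum>i<n. scaleC (a' i) (v i)) + scaleC (a' n) (v n) \<and> (\<forall>i<Suc n. cmod (a' i) \<le> 1)"
        by (intro exI[of _ "a(n := c)"]) (auto simp: less_Suc_eq)
    qed
  qed
  then show ?case
    using compact_continuous_image[OF cont compact_Times[OF Suc compact_cball]] by simp
qed

text \<open>The coordinates of unit vectors are bounded by 1, so the unit sphere of M is a closed
  subset of a compact set, and the continuous function \<open>norm (T x)\<close> has a maximum on
  it.\<close>

lemma norm_attaining_on_finite_dimensional:
  assumes M: "csubspace M" "closed M" "M \<noteq> {0}"
    and v: "orthonormal_in M n v" "\<And>x. x \<in> M \<Longrightarrow> x = (\<Sum>i<n. scaleC (cinner x (v i)) (v i))"
    and T: "bounded_linear T"
  shows "norm_attaining_on M T"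
proof -
  let ?K = "{(\<Sum>i<n. scaleC (a i) (v i)) |a. \<forall>i<n. cmod (a i) \<le> 1}"
  define S where "S = M \<inter> {x. norm x = 1}"
  have "S \<subseteq> ?K"
  proof
    fix x assume x: "x \<in> S"
    have "cmod (cinner x (v i)) \<le> 1" if "i < n" for i
    proof -
      have "norm (v i) = 1"
        using v(1) that by (auto simp: norm_eq_one_iff_cinner orthonormal_in_def)
      then show ?thesis
        using cmod_cinner_le[of x "v i"] x by (simp add: S_def)
    qed
    then show "x \<in> ?K"
      using v(2)[of x] x by (auto simp: S_def)
  qed
  then have "?K \<inter> S = S" by auto
  moreover have "closed S"
    unfolding S_def using M by (intro closed_Int closed_Collect_eq continuous_intros)
  from compact_Int_closed[OF compact_bounded_combinations this]
  have "compact (?K \<inter> S)" .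
  ultimately have "compact S"
    by (simp only:)
  moreover obtain y where y: "y \<in> M" "y \<noteq> 0"
    using M by (auto simp: csubspace_def)
  have normalized: "inverse (norm z) *\<^sub>R z \<in> S" if "z \<in> M" "z \<noteq> 0" for z
    using csubspace_normalize[OF M(1) that] by (simp add: S_def)
  have "S \<noteq> {}"
    using normalized[OF y] by auto
  moreover have "continuous_on S (\<lambda>x. norm (T x))"
    by (intro continuous_on_norm linear_continuous_on T)
  ultimately obtain x where x: "x \<in> S" "\<And>z. z \<in> S \<Longrightarrow> norm (T z) \<le> norm (T x)"
    using continuous_attains_sup[of S "\<lambda>x. norm (T x)"] by blast
  show ?thesis
  proof (rule norm_attaining_onI)
    show "x \<in> M" "norm x = 1"
      using x by (auto simp: S_def)
    fix z assume z: "z \<in> M"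
    show "norm (T z) \<le> norm (T x) * norm z"
    proof (cases "z = 0")
      case False
      have "norm (T (inverse (norm z) *\<^sub>R z)) \<le> norm (T x)"
        by (rule x(2)[OF normalized[OF z False]])
      then show ?thesis
        using False by (simp add: linear_scale[OF bounded_linear.linear[OF T]] field_simps)
    qed (simp add: linear_0[OF bounded_linear.linear[OF T]])
  qed
qed

section \<open>The essential supremum norm and bounds for Toeplitz operators\<close>

lemma Linfinity_norm:
  assumes "\<phi> \<in> Linfinity"
  shows "AE z in circle. cmod (\<phi> z) \<le> Linfinity_norm \<phi>" "0 \<le> Linfinity_norm \<phi>"
    "\<And>t. AE z in circle. cmod (\<phi> z) \<le> t \<Longrightarrow> Linfinity_norm \<phi> \<le> t"
proof -
  interpret prob_space circle by (rule prob_space_circle)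
  define E where "E = esssup circle (\<lambda>z. ereal (cmod (\<phi> z)))"
  have [measurable]: "\<phi> \<in> borel_measurable circle"
    using assms by (simp add: Linfinity_def)
  have le: "E \<le> ereal t" if "AE z in circle. cmod (\<phi> z) \<le> t" for t
    unfolding E_def by (rule esssup_I) (use that in auto)
  obtain C where "AE z in circle. cmod (\<phi> z) \<le> C"
    using assms by (auto simp: Linfinity_def)
  then have "E \<le> ereal C" by (rule le)
  \<comment> \<open>The essential supremum of a constant is that constant because the circle has
    positive measure. Thus E lies between 0 and C and is finite, so passing to a real number loses
    nothing.\<close>
  moreover have "(0::ereal) = esssup circle (\<lambda>_. 0)"
    by (rule esssup_const[symmetric]) (simp add: emeasure_space_1)
  then have "0 \<le> E"
    unfolding E_def by (metis (mono_tags) borel_measurable_const ereal_less_eq(5) esssup_mono norm_ge_zero)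
  ultimately have E: "E = ereal (Linfinity_norm \<phi>)" "0 \<le> Linfinity_norm \<phi>"
    unfolding Linfinity_norm_def E_def[symmetric] by (cases E; auto)+
  show "AE z in circle. cmod (\<phi> z) \<le> Linfinity_norm \<phi>"
    using esssup_AE[of "\<lambda>z. ereal (cmod (\<phi> z))" circle] unfolding E_def[symmetric] E(1) by simp
  show "0 \<le> Linfinity_norm \<phi>" by (rule E)
  show "Linfinity_norm \<phi> \<le> t" if "AE z in circle. cmod (\<phi> z) \<le> t" for t
    using le[OF that] E by simp
qed

lemma bounded_linear_toeplitz:
  assumes "\<phi> \<in> Linfinity"
  shows "bounded_linear (toeplitz \<phi>)"
  unfolding toeplitz_def[abs_def]
  by (intro bounded_linear_compose[OF bounded_linear_orth_proj_H2] bounded_linear_multiplication assms)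

lemma bounded_clinear_on_toeplitz:
  assumes "\<phi> \<in> Linfinity"
  shows "bounded_clinear_on H2 H2 (toeplitz \<phi>)"
proof -
  have "\<exists>B. \<forall>x. norm (toeplitz \<phi> x) \<le> B * norm x"
    using bounded_linear.bounded[OF bounded_linear_toeplitz[OF assms]] by (metis mult.commute)
  then show ?thesis
    using assms
    by (auto simp: bounded_clinear_on_def toeplitz_def orth_proj_in_H2 multiplication_add
        multiplication_scaleC orth_proj_H2_add orth_proj_H2_scaleC)
qed

lemma norm_toeplitz_le:
  assumes "\<phi> \<in> Linfinity"
  shows "norm (toeplitz \<phi> f) \<le> Linfinity_norm \<phi> * norm f"
  unfolding toeplitz_def
  using norm_orth_proj_H2_le norm_multiplication_le[OF assms Linfinity_norm(1,2)[OF assms]]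
  by (rule order_trans)

section \<open>Unimodular symbols with rational co-analytic part\<close>

lemma norm_multiplication_unimodular:
  assumes "\<phi> \<in> Linfinity" "AE z in circle. cmod (\<phi> z) = C" "0 \<le> C"
  shows "norm (multiplication \<phi> f) = C * norm f"
proof -
  obtain u where u: "u \<in> square_integrable" "f = L2_class u"
    by (metis L2_class_cases)
  have "norm (L2_class (\<lambda>z. \<phi> z * u z)) = norm (L2_class (\<lambda>z. of_real C * u z))"
    by (intro antisym norm_L2_class_mono mult_square_integrable scale_square_integrable assms u)
       (use assms(2,3) in \<open>auto simp: norm_mult elim!: eventually_mono\<close>)
  also have "\<dots> = C * norm f"
    using u assms(3) by (simp add: L2_class_scaleC[symmetric] norm_scaleC)
  finally show ?thesis
    using assms u by (simp add: multiplication_L2_class)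
qed

text \<open>Each vanishing negative coefficient of q k expresses one coefficient of k through
  \<open>degree q\<close> coefficients at frequencies closer to 0, since the leading coefficient of
  q is nonzero. With \<open>degree q\<close> vanishing initial values, all negative coefficients
  vanish; they are numbered as -1 - i with i \<ge> 0.\<close>

lemma in_H2_if_poly_mult_in_H2:
  assumes qk: "multiplication (poly q) k \<in> H2" and q: "q \<noteq> 0"
    and init: "\<And>i. i < degree q \<Longrightarrow> fourier_coeff k (- 1 - int i) = 0"
  shows "k \<in> H2"
proof -
  define d where "d = degree q"
  have coeffs: "fourier_coeff k (- 1 - int i) = 0" for i
  proof (induction i rule: less_induct)
    case (less i)
    show ?case
    proof (cases "i < d")
      case False
      \<comment> \<open>The recurrence is read at the negative index -1 - (i - d), where the summand
        j = d contains the unknown coefficient at -1 - i.\<close>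
      then have idx: "- 1 - int (i - d) - int d = - 1 - int i" by simp
      have "0 = (\<Sum>j\<le>d. coeff q j * fourier_coeff k (- 1 - int (i - d) - int j))"
        using qk unfolding H2_iff fourier_coeff_poly_mult d_def by simp
      also have "\<dots> = (\<Sum>j\<le>d. if j = d then coeff q d * fourier_coeff k (- 1 - int i) else 0)"
      proof (rule sum.cong)
        fix j assume j: "j \<in> {..d}"
        show "coeff q j * fourier_coeff k (- 1 - int (i - d) - int j) =
            (if j = d then coeff q d * fourier_coeff k (- 1 - int i) else 0)"
        proof (cases "j = d")
          case False
          then have "i - d + j < i" "- 1 - int (i - d) - int j = - 1 - int (i - d + j)"
            using j \<open>\<not> i < d\<close> by auto
          then have "fourier_coeff k (- 1 - int (i - d) - int j) = 0"
            using less[of "i - d + j"] by presburger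
          then show ?thesis
            using False by simp
        qed (simp only: idx if_True refl)
      qed simp
      also have "\<dots> = coeff q d * fourier_coeff k (- 1 - int i)"
        by simp
      finally show ?thesis
        using q by (simp add: d_def)
    qed (use init in \<open>simp add: d_def\<close>)
  qed
  have "fourier_coeff k n = 0" if "n < 0" for n
    using coeffs[of "nat (- 1 - n)"] that by simp
  then show ?thesis
    by (simp add: H2_iff)
qed

text \<open>The denominator q works: q (I - P)\<phi> is the numerator, a polynomial, and q P\<phi>
  is analytic.\<close>

lemma rational_on_circle_imp_poly_mult:
  assumes "\<phi> \<in> Linfinity" "rational_on_circle (L2_class \<phi> - orth_proj H2 (L2_class \<phi>))"
  obtains q where "q \<noteq> 0" "multiplication (poly q) (L2_class \<phi>) \<in> H2"
proof -
  define h where "h = L2_class \<phi> - orth_proj H2 (L2_class \<phi>)"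
  obtain u where u: "u \<in> square_integrable" "h = L2_class u"
    by (metis L2_class_cases)
  then obtain p q where pq: "q \<noteq> 0" "AE z in circle. u z = poly p z / poly q z"
    using assms(2) by (auto simp: h_def[symmetric] rational_on_circle_L2_class)
  have "AE z in circle. poly q z * u z = poly p z"
    using pq(2) AE_poly_nonzero[OF pq(1)] by eventually_elim simp
  then have "multiplication (poly q) h = poly_L2 p"
    using u by (simp add: multiplication_L2_class poly_Linfinity poly_L2_def L2_class_eq_iff
        mult_square_integrable poly_square_integrable)
  moreover have "multiplication (poly q) (orth_proj H2 (L2_class \<phi>)) \<in> H2"
    using poly_L2_in_H2[of q] by (intro multiplication_in_H2 poly_Linfinity orth_proj_in_H2)
      (simp add: poly_L2_def)
  moreover have "L2_class \<phi> = h + orth_proj H2 (L2_class \<phi>)"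
    by (simp add: h_def)
  then have "multiplication (poly q) (L2_class \<phi>) =
      multiplication (poly q) h + multiplication (poly q) (orth_proj H2 (L2_class \<phi>))"
    by (metis multiplication_add poly_Linfinity)
  ultimately have "multiplication (poly q) (L2_class \<phi>) \<in> H2"
    using csubspace_H2 poly_L2_in_H2[of p] by (simp add: csubspace_def)
  with pq(1) show ?thesis by (rule that)
qed

lemma toeplitz_AN_if:
  assumes \<phi>: "\<phi> \<in> Linfinity" and unimodular: "AE z in circle. cmod (\<phi> z) = Linfinity_norm \<phi>"
    and rational: "rational_on_circle (L2_class \<phi> - orth_proj H2 (L2_class \<phi>))"
  shows "toeplitz \<phi> \<in> AN_operators H2"
proof -
  obtain q where q: "q \<noteq> 0" "multiplication (poly q) (L2_class \<phi>) \<in> H2"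
    using rational_on_circle_imp_poly_mult[OF \<phi> rational] .
  define C where "C = Linfinity_norm \<phi>"
  have "norm_attaining_on M (toeplitz \<phi>)"
    if M: "csubspace M" "closed M" "M \<subseteq> H2" "M \<noteq> {0}" for M
  proof -
    \<comment> \<open>Either M has more independent vectors than there are initial values, or it has
      a finite orthonormal basis.\<close>
    consider v where "orthonormal_in M (Suc (degree q)) v"
      | n v where "orthonormal_in M n v" "\<And>x. x \<in> M \<Longrightarrow> x = (\<Sum>i<n. scaleC (cinner x (v i)) (v i))"
      using orthonormal_in_extend_or_span[OF M(1), of "Suc (degree q)"] by blast
    then show ?thesis
    proof cases
      case v: 1
      \<comment> \<open>There are \<open>degree q\<close> conditions, on the coefficients of \<phi>
        f at -1, ..., -\<open>degree q\<close>, and one more unknown than conditions.\<close>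
      obtain c where c: "\<exists>j<Suc (degree q). c j \<noteq> 0"
        "\<forall>i<degree q. (\<Sum>j<Suc (degree q). c j * fourier_coeff (multiplication \<phi> (v j)) (- 1 - int i)) = 0"
        using homogeneous_system_nontrivial_solution[of "{..<Suc (degree q)}" "degree q"
            "\<lambda>i j. fourier_coeff (multiplication \<phi> (v j)) (- 1 - int i)"] by auto
      define f where "f = (\<Sum>j<Suc (degree q). scaleC (c j) (v j))"
      have "f \<in> M"
        unfolding f_def using v by (intro csubspace_sum csubspace_scaleC M) (auto simp: orthonormal_in_def)
      obtain j where "j < Suc (degree q)" "c j \<noteq> 0"
        using c(1) by auto
      then have "(\<Sum>j<Suc (degree q). (cmod (c j))\<^sup>2) > 0"
        by (intro sum_pos2[of _ j]) auto
      then have "f \<noteq> 0"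
        using norm_sum_orthonormal_in[OF v, of c] by (auto simp: f_def)
      have "multiplication \<phi> f = (\<Sum>j<Suc (degree q). scaleC (c j) (multiplication \<phi> (v j)))"
        unfolding f_def
        by (simp only: linear_sum[OF bounded_linear.linear[OF bounded_linear_multiplication[OF \<phi>]]]
            multiplication_scaleC[OF \<phi>])
      then have coeffs: "fourier_coeff (multiplication \<phi> f) (- 1 - int i) = 0" if "i < degree q" for i
        using c(2) that by (simp add: fourier_coeff_sum fourier_coeff_scaleC fourier_coeff_add)
      have "multiplication (poly q) (multiplication \<phi> f) \<in> H2"
      proof -
        have "multiplication (poly q) (multiplication \<phi> f) = multiplication (\<lambda>z. poly q z * \<phi> z) f"
          by (intro multiplication_multiplication poly_Linfinity \<phi>)
        moreover have "multiplication (poly q) (L2_class \<phi>) = L2_class (\<lambda>z. poly q z * \<phi> z)"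
          by (intro multiplication_L2_class poly_Linfinity Linfinity_square_integrable \<phi>)
        ultimately show ?thesis
          using q(2) \<open>f \<in> M\<close> M(3)
          by (auto intro!: multiplication_in_H2 mult_Linfinity poly_Linfinity \<phi>)
      qed
      then have "multiplication \<phi> f \<in> H2"
        by (rule in_H2_if_poly_mult_in_H2) (use q(1) coeffs in auto)
      \<comment> \<open>The projection does nothing to \<phi> f, so f attains the upper bound that
        holds on all of \<open>H2\<close>.\<close>
      then have "norm (toeplitz \<phi> f) = C * norm f"
        using norm_multiplication_unimodular[OF \<phi> unimodular Linfinity_norm(2)[OF \<phi>]]
        by (simp add: toeplitz_def orth_proj_H2_ident C_def)
      define x where "x = inverse (norm f) *\<^sub>R f"
      have "norm (toeplitz \<phi> x) = C"
        using \<open>f \<noteq> 0\<close> \<open>norm (toeplitz \<phi> f) = C * norm f\<close>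
        by (simp add: x_def linear_scale[OF bounded_linear.linear[OF bounded_linear_toeplitz[OF \<phi>]]])
      moreover have "x \<in> M" "norm x = 1"
        unfolding x_def using csubspace_normalize[OF M(1) \<open>f \<in> M\<close> \<open>f \<noteq> 0\<close>] by auto
      ultimately show ?thesis
        using norm_toeplitz_le[OF \<phi>] by (intro norm_attaining_onI[of x]) (auto simp: C_def)
    next
      case 2
      then show ?thesis
        by (intro norm_attaining_on_finite_dimensional bounded_linear_toeplitz M \<phi>)
    qed
  qed
  then show ?thesis
    using bounded_clinear_on_toeplitz[OF \<phi>] by (auto simp: AN_operators_def)
qed

subsection \<open>Necessity\<close>

text \<open>Let h = (I - P)\<phi>. As the difference of q \<phi> and q P\<phi>, the product q h has
  no negative frequencies; as h has only negative ones, q h has none from \<open>degree q\<close>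
  on. So q h is a polynomial.\<close>

lemma poly_mult_in_H2_imp_rational:
  assumes \<phi>: "\<phi> \<in> Linfinity" and q: "q \<noteq> 0" "multiplication (poly q) (L2_class \<phi>) \<in> H2"
  shows "rational_on_circle (L2_class \<phi> - orth_proj H2 (L2_class \<phi>))"
proof -
  define h where "h = L2_class \<phi> - orth_proj H2 (L2_class \<phi>)"
  have h: "fourier_coeff h n = 0" if "0 \<le> n" for n
    using that by (simp add: h_def fourier_coeff_diff fourier_coeff_orth_proj)
  define g where "g = multiplication (poly q) h"
  have "multiplication (poly q) (orth_proj H2 (L2_class \<phi>)) \<in> H2"
    using poly_L2_in_H2[of q] by (intro multiplication_in_H2 poly_Linfinity orth_proj_in_H2)
      (simp add: poly_L2_def)
  moreover have "g = multiplication (poly q) (L2_class \<phi>) - multiplication (poly q) (orth_proj H2 (L2_class \<phi>))"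
    unfolding g_def h_def
    by (intro linear_diff bounded_linear.linear bounded_linear_multiplication poly_Linfinity)
  ultimately have g_H2: "g \<in> H2"
    using q(2) by (simp add: csubspace_diff csubspace_H2)
  have g_high: "fourier_coeff g (int n) = 0" if "degree q \<le> n" for n
    unfolding g_def fourier_coeff_poly_mult using that by (intro sum.neutral) (auto intro!: h)
  define p where "p = (\<Sum>i<degree q. monom (fourier_coeff g (int i)) i)"
  have "coeff p n = fourier_coeff g (int n)" for n
    using g_high[of n] by (auto simp: p_def coeff_sum)
  then have "poly_L2 p = g"
    using g_H2 by (intro fourier_coeff_inject) (auto simp: fourier_coeff_poly_L2 H2_iff)
  moreover obtain u where u: "u \<in> square_integrable" "h = L2_class u"
    by (metis L2_class_cases)
  ultimately have "AE z in circle. poly p z = poly q z * u z"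
    by (simp add: g_def multiplication_L2_class poly_Linfinity poly_L2_def L2_class_eq_iff
        mult_square_integrable poly_square_integrable)
  with AE_poly_nonzero[OF q(1)] have "AE z in circle. u z = poly p z / poly q z"
    by eventually_elim simp
  then show ?thesis
    using u q(1) by (auto simp: h_def[symmetric] rational_on_circle_L2_class)
qed

section \<open>High shifts and approximation by trigonometric polynomials\<close>

lemma shift_shift: "shift_L2 m (shift_L2 n f) = shift_L2 (m + n) f"
  by (rule fourier_coeff_inject) (simp add: fourier_coeff_shift algebra_simps)

lemma multiplication_shift:
  "\<phi> \<in> Linfinity \<Longrightarrow> multiplication \<phi> (shift_L2 n f) = shift_L2 n (multiplication \<phi> f)"
  by (simp add: shift_L2_def multiplication_commute powi_Linfinity)

lemma bounded_linear_shift: "bounded_linear (shift_L2 n)"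
  unfolding shift_L2_def[abs_def] by (intro bounded_linear_multiplication powi_Linfinity)

lemma trigonometric_polynomial_approximation:
  assumes "e > 0"
  obtains u' g n where "norm (u - u') < e" "shift_L2 (int n) u' = poly_L2 g"
proof -
  let ?t = "\<lambda>i. scaleC (fourier_coeff u (int_decode i)) (monomial_L2 (int_decode i))"
  have "?t sums u"
    by (rule fourier_expansion) (auto simp: surj_int_decode inj_int_decode)
  then obtain N where "norm ((\<Sum>i<N. ?t i) - u) < e"
    using LIMSEQ_D[OF _ assms] unfolding sums_def by blast
  then have "norm (u - (\<Sum>i<N. ?t i)) < e"
    by (simp add: norm_minus_commute)
  \<comment> \<open>The sum exceeds the modulus of each frequency in the partial sum, so shifting by
    n leaves only nonnegative frequencies.\<close>
  moreover define n where "n = (\<Sum>i<N. nat \<bar>int_decode i\<bar>)"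
  have n: "0 \<le> int_decode i + int n" if "i < N" for i
  proof -
    have "nat \<bar>int_decode i\<bar> \<le> n"
      unfolding n_def using that by (intro member_le_sum) auto
    then show ?thesis by linarith
  qed
  define g where "g = (\<Sum>i<N. monom (fourier_coeff u (int_decode i)) (nat (int_decode i + int n)))"
  have "shift_L2 (int n) (\<Sum>i<N. ?t i) = poly_L2 g"
  proof (rule fourier_coeff_inject)
    fix m
    have "fourier_coeff (?t i) (m - int n) =
        fourier_coeff (poly_L2 (monom (fourier_coeff u (int_decode i)) (nat (int_decode i + int n)))) m"
      if "i < N" for i
      using n[OF that]
      by (auto simp: fourier_coeff_scaleC fourier_coeff_monomial fourier_coeff_poly_L2)
    then show "fourier_coeff (shift_L2 (int n) (\<Sum>i<N. ?t i)) m = fourier_coeff (poly_L2 g) m"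
      by (simp add: fourier_coeff_shift fourier_coeff_sum g_def poly_L2_sum)
  qed
  ultimately show ?thesis by (rule that)
qed

lemma shift_in_H2_mono:
  assumes "shift_L2 m f \<in> H2" "m \<le> n"
  shows "shift_L2 n f \<in> H2"
proof -
  have "fourier_coeff f (k - n) = 0" if "k < 0" for k
    using assms that by (simp add: H2_iff fourier_coeff_shift) (drule spec[of _ "k - n + m"], simp)
  then show ?thesis by (simp add: H2_iff fourier_coeff_shift)
qed

text \<open>A trigonometric polynomial close to u is shifted into \<open>H2\<close> eventually; only
  the shifted error contributes from then on, and shifts preserve its norm.\<close>

lemma shift_asymptotically_analytic:
  "(\<lambda>n. norm (shift_L2 (int n) u - orth_proj H2 (shift_L2 (int n) u))) \<longlonglongrightarrow> 0"
proof (rule LIMSEQ_I)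
  fix e :: real assume "e > 0"
  then obtain u' g N where u': "norm (u - u') < e" "shift_L2 (int N) u' = poly_L2 g"
    by (rule trigonometric_polynomial_approximation)
  have "norm (shift_L2 (int n) u - orth_proj H2 (shift_L2 (int n) u)) < e" if "N \<le> n" for n
  proof -
    define r where "r = shift_L2 (int n) (u - u')"
    have "shift_L2 (int n) u' \<in> H2"
      by (rule shift_in_H2_mono[of "int N"]) (use u' that poly_L2_in_H2 in auto)
    moreover have "shift_L2 (int n) u = r + shift_L2 (int n) u'"
      by (simp add: r_def linear_diff[OF bounded_linear.linear[OF bounded_linear_shift]])
    ultimately have "shift_L2 (int n) u - orth_proj H2 (shift_L2 (int n) u) = r - orth_proj H2 r"
      by (simp add: orth_proj_H2_add orth_proj_H2_ident)
    also have "norm \<dots> \<le> norm r"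
      by (rule norm_diff_orth_proj_H2_le)
    also have "\<dots> < e"
      using u' by (simp add: r_def)
    finally show ?thesis .
  qed
  then show "\<exists>N. \<forall>n\<ge>N. norm (norm (shift_L2 (int n) u - orth_proj H2 (shift_L2 (int n) u)) - 0) < e"
    by auto
qed

section \<open>The defect operator\<close>

definition defect_symbol :: "(complex \<Rightarrow> complex) \<Rightarrow> complex \<Rightarrow> complex" where
  "defect_symbol \<phi> z = of_real (sqrt ((Linfinity_norm \<phi>)\<^sup>2 - (cmod (\<phi> z))\<^sup>2))"

text \<open>The operator W of the overview, with \<open>defect_symbol\<close> as \<psi>. The norm of
  the product type is the Hilbert norm of the direct sum.\<close>

definition defect :: "(complex \<Rightarrow> complex) \<Rightarrow> L2 \<Rightarrow> L2 \<times> L2" where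
  "defect \<phi> f = (multiplication (defect_symbol \<phi>) f,
                 multiplication \<phi> f - orth_proj H2 (multiplication \<phi> f))"

text \<open>The complex inner product that induces the norm of the product, needed for complex
  orthogonality of values of \<open>defect\<close>.\<close>

definition cinner_pair :: "L2 \<times> L2 \<Rightarrow> L2 \<times> L2 \<Rightarrow> complex" where
  "cinner_pair x y = cinner (fst x) (fst y) + cinner (snd x) (snd y)"

lemma cinner_pair_commute: "cinner_pair x y = cnj (cinner_pair y x)"
  unfolding cinner_pair_def by (subst (1 2) cinner_commute) simp

lemma cinner_pair_self: "cinner_pair x x = of_real ((norm x)\<^sup>2)"
  by (cases x) (simp add: cinner_pair_def cinner_self norm_Pair)

context
  fixes \<phi> assumes \<phi>: "\<phi> \<in> Linfinity"
begin

lemma cmod_defect_symbol: "AE z in circle. (cmod (defect_symbol \<phi> z))\<^sup>2 = (Linfinity_norm \<phi>)\<^sup>2 - (cmod (\<phi> z))\<^sup>2"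
  using Linfinity_norm(1)[OF \<phi>]
proof eventually_elim
  case (elim z)
  then have "(cmod (\<phi> z))\<^sup>2 \<le> (Linfinity_norm \<phi>)\<^sup>2"
    by (intro power_mono) auto
  then show ?case by (simp add: defect_symbol_def)
qed

lemma cmod_defect_symbol_le: "AE z in circle. cmod (defect_symbol \<phi> z) \<le> Linfinity_norm \<phi>"
  using cmod_defect_symbol
proof eventually_elim
  case (elim z)
  then show ?case
    by (intro power2_le_imp_le[OF _ Linfinity_norm(2)[OF \<phi>]]) simp
qed

lemma defect_symbol_Linfinity: "defect_symbol \<phi> \<in> Linfinity"
proof -
  have [measurable]: "\<phi> \<in> borel_measurable circle"
    using \<phi> by (simp add: Linfinity_def)
  have "defect_symbol \<phi> \<in> borel_measurable circle"
    unfolding defect_symbol_def[abs_def] by measurable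
  then show ?thesis
    using cmod_defect_symbol_le by (auto simp: Linfinity_def)
qed

lemma bounded_linear_defect: "bounded_linear (defect \<phi>)"
  unfolding defect_def[abs_def]
  by (intro bounded_linear_Pair bounded_linear_sub bounded_linear_multiplication
      bounded_linear_compose[OF bounded_linear_orth_proj_H2] \<phi> defect_symbol_Linfinity)

lemma defect_scaleC:
  "fst (defect \<phi> (scaleC c f)) = scaleC c (fst (defect \<phi> f))"
  "snd (defect \<phi> (scaleC c f)) = scaleC c (snd (defect \<phi> f))"
proof -
  have "scaleC c x - scaleC c y = scaleC c (x - y)" for x y
    by (rule linear_diff[OF bounded_linear.linear[OF bounded_linear_scaleC], symmetric])
  then show "fst (defect \<phi> (scaleC c f)) = scaleC c (fst (defect \<phi> f))"
    "snd (defect \<phi> (scaleC c f)) = scaleC c (snd (defect \<phi> f))"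
    by (simp_all add: defect_def multiplication_scaleC \<phi> defect_symbol_Linfinity orth_proj_H2_scaleC)
qed

lemma norm_defect_scaleC: "norm (defect \<phi> (scaleC c f)) = cmod c * norm (defect \<phi> f)"
  using defect_scaleC[of c f]
  by (simp add: norm_prod_def norm_scaleC power_mult_distrib real_sqrt_mult flip: distrib_left)

text \<open>Integrating \<open>|\<psi>|\<^sup>2 + |\<phi>|\<^sup>2 = c\<^sup>2\<close> against
  \<open>|f|\<^sup>2\<close> gives the sum for \<psi> f and \<phi> f, and Pythagoras splits \<phi> f
  by the projection. So f attains the bound c exactly if its defect is 0.\<close>

lemma norm_defect:
  "(norm (defect \<phi> f))\<^sup>2 = (Linfinity_norm \<phi>)\<^sup>2 * (norm f)\<^sup>2 - (norm (toeplitz \<phi> f))\<^sup>2"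
proof -
  obtain u where u: "u \<in> square_integrable" "f = L2_class u"
    by (metis L2_class_cases)
  have int: "integrable circle (\<lambda>z. (cmod (g z * u z))\<^sup>2)" if "g \<in> Linfinity" for g
    by (intro square_integrableD(2) mult_square_integrable that u)
  have [measurable]: "(\<lambda>z. (cmod (u z))\<^sup>2) \<in> borel_measurable circle"
    using square_integrableD(2)[OF u(1)] by auto
  have "(norm (multiplication (defect_symbol \<phi>) f))\<^sup>2 + (norm (multiplication \<phi> f))\<^sup>2 =
      (\<integral>z. (cmod (defect_symbol \<phi> z * u z))\<^sup>2 + (cmod (\<phi> z * u z))\<^sup>2 \<partial>circle)"
    using u \<phi> defect_symbol_Linfinity
    by (simp add: multiplication_L2_class norm_L2_class mult_square_integrable int)
  also have "\<dots> = (\<integral>z. (Linfinity_norm \<phi>)\<^sup>2 * (cmod (u z))\<^sup>2 \<partial>circle)"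
  proof (rule integral_cong_AE)
    show "AE z in circle. (cmod (defect_symbol \<phi> z * u z))\<^sup>2 + (cmod (\<phi> z * u z))\<^sup>2 =
        (Linfinity_norm \<phi>)\<^sup>2 * (cmod (u z))\<^sup>2"
      using cmod_defect_symbol
      by eventually_elim (simp add: norm_mult power_mult_distrib left_diff_distrib)
  qed (use int \<phi> defect_symbol_Linfinity in \<open>auto intro!: borel_measurable_add\<close>)
  also have "\<dots> = (Linfinity_norm \<phi>)\<^sup>2 * (norm f)\<^sup>2"
    using u by (simp add: norm_L2_class)
  finally show ?thesis
    using norm_orth_proj_H2[of "multiplication \<phi> f"]
    by (simp add: defect_def norm_Pair toeplitz_def)
qed

text \<open>On the indicator h of a set where |\<phi>| is close to c, multiplication by \<psi> is
  small, and shifts keep it so. The other component fades under high shifts. A trigonometric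
  polynomial h' near h, shifted, supplies g. The bound for all high shifts lets several of them be
  used together.\<close>

lemma defect_small_after_shift:
  assumes "e > 0"
  obtains g N where "g \<noteq> 0"
    "\<And>n. N \<le> n \<Longrightarrow> norm (defect \<phi> (shift_L2 (int n) (poly_L2 g))) \<le> e * norm (poly_L2 g)"
proof -
  define C where "C = Linfinity_norm \<phi>"
  have C: "0 \<le> C"
    using Linfinity_norm(2)[OF \<phi>] by (simp add: C_def)
  have [measurable]: "\<phi> \<in> borel_measurable circle"
    using \<phi> by (simp add: Linfinity_def)
  \<comment> \<open>The \<psi>-component of h' costs 2 s \<open>norm h\<close>, and
    \<open>norm h\<close> is at most 2 \<open>norm h'\<close>; with s = e / 8 this is e / 2 times
    \<open>norm h'\<close>.\<close>
  define s where "s = e / 8"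
  have s: "s > 0" using assms by (simp add: s_def)
  \<comment> \<open>On A the difference of squares is at most d times 2 C, which must not exceed the
    square of s; adding 1 to the denominator covers C = 0.\<close>
  define d where "d = s\<^sup>2 / (2 * C + 1)"
  have d: "d > 0" "2 * C * d \<le> s\<^sup>2"
    using s C by (auto simp: d_def field_simps intro: add_nonneg_pos)
  define A where "A = {z \<in> space circle. C - d < cmod (\<phi> z)}"
  have [measurable]: "A \<in> sets circle"
    unfolding A_def by measurable
  let ?ind = "\<lambda>z. indicator A z :: complex"
  have ind: "?ind \<in> Linfinity"
    by (auto simp: Linfinity_def indicator_def intro!: exI[of _ 1])
  have ind_sq: "?ind \<in> square_integrable"
    by (rule Linfinity_square_integrable[OF ind])
  define h where "h = L2_class ?ind"
  \<comment> \<open>Otherwise C - d would be an essential bound below the essential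
    supremum.\<close>
  have "h \<noteq> 0"
  proof
    assume "h = 0"
    then have "AE z in circle. ?ind z = 0"
      using L2_class_eq_iff[OF ind_sq zero_square_integrable] by (simp add: h_def L2_class_zero)
    with AE_space have "AE z in circle. cmod (\<phi> z) \<le> C - d"
      by eventually_elim (auto simp: A_def indicator_def split: if_splits)
    then show False
      using Linfinity_norm(3)[OF \<phi>, of "C - d"] d by (simp add: C_def)
  qed
  then have h: "norm h > 0" by simp
  have \<psi>h: "norm (multiplication (defect_symbol \<phi>) h) \<le> s * norm h"
  proof -
    have "norm (L2_class (\<lambda>z. defect_symbol \<phi> z * ?ind z)) \<le> norm (L2_class (\<lambda>z. of_real s * ?ind z))"
    proof (rule norm_L2_class_mono)
      show "AE z in circle. cmod (defect_symbol \<phi> z * ?ind z) \<le> cmod (of_real s * ?ind z)"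
        using cmod_defect_symbol Linfinity_norm(1)[OF \<phi>]
      proof eventually_elim
        case (elim z)
        have "cmod (defect_symbol \<phi> z) \<le> s" if "z \<in> A"
        proof (rule power2_le_imp_le)
          have "C\<^sup>2 - (cmod (\<phi> z))\<^sup>2 = (C - cmod (\<phi> z)) * (C + cmod (\<phi> z))"
            by (simp add: power2_eq_square algebra_simps)
          also have "\<dots> \<le> d * (2 * C)"
            using that elim C d by (intro mult_mono) (auto simp: A_def C_def)
          finally show "(cmod (defect_symbol \<phi> z))\<^sup>2 \<le> s\<^sup>2"
            using elim d by (simp add: C_def mult_ac)
        qed (use s in simp)
        then show ?case
          using s by (auto simp: indicator_def)
      qed
    qed (intro mult_square_integrable scale_square_integrable ind_sq defect_symbol_Linfinity)+
    also have "\<dots> = s * norm h"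
      using s ind_sq by (simp add: h_def L2_class_scaleC[symmetric] norm_scaleC)
    finally show ?thesis
      using ind_sq by (simp add: h_def multiplication_L2_class defect_symbol_Linfinity)
  qed
  \<comment> \<open>The first bound keeps \<open>norm h'\<close> above half of
    \<open>norm h\<close>, the second makes the error in the \<psi>-component at most s
    \<open>norm h\<close>.\<close>
  define \<eta> where "\<eta> = min (norm h / 2) (s * norm h / (C + 1))"
  have \<eta>: "\<eta> > 0" "\<eta> \<le> norm h / 2" "C * \<eta> \<le> s * norm h"
  proof -
    show "\<eta> > 0"
      using h s C by (simp add: \<eta>_def)
    show "\<eta> \<le> norm h / 2"
      unfolding \<eta>_def by (rule min.cobounded1)
    have "(C + 1) * \<eta> \<le> (C + 1) * (s * norm h / (C + 1))"
      unfolding \<eta>_def using C by (intro mult_left_mono) auto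
    then have "(C + 1) * \<eta> \<le> s * norm h"
      using C by simp
    then show "C * \<eta> \<le> s * norm h"
      using \<open>\<eta> > 0\<close> by (simp add: algebra_simps)
  qed
  obtain h' g m where h': "norm (h - h') < \<eta>" "shift_L2 (int m) h' = poly_L2 g"
    using trigonometric_polynomial_approximation[OF \<eta>(1)] .
  have norm_h': "norm h / 2 \<le> norm h'"
    using h'(1) \<eta>(2) norm_triangle_sub[of h h'] by linarith
  have norm_g: "norm (poly_L2 g) = norm h'"
    by (simp flip: h'(2))
  have \<psi>h': "norm (multiplication (defect_symbol \<phi>) h') \<le> e / 2 * norm h'"
  proof -
    have "norm (multiplication (defect_symbol \<phi>) (h - h')) \<le> C * norm (h - h')"
      unfolding C_def
      by (intro norm_multiplication_le defect_symbol_Linfinity cmod_defect_symbol_le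
          Linfinity_norm(2) \<phi>)
    also have "\<dots> \<le> C * \<eta>"
      using h'(1) C by (intro mult_left_mono) auto
    finally have "norm (multiplication (defect_symbol \<phi>) h - multiplication (defect_symbol \<phi>) h') \<le> s * norm h"
      using \<eta>(3)
      by (simp add: linear_diff[OF bounded_linear.linear[OF
            bounded_linear_multiplication[OF defect_symbol_Linfinity]]])
    then have "norm (multiplication (defect_symbol \<phi>) h') \<le> s * norm h + s * norm h"
      using \<psi>h norm_triangle_sub[of "multiplication (defect_symbol \<phi>) h'" "multiplication (defect_symbol \<phi>) h"]
      by (simp add: norm_minus_commute)
    also have "\<dots> = e / 2 * (norm h / 2)"
      by (simp add: s_def)
    also have "\<dots> \<le> e / 2 * norm h'"
      using norm_h' assms by (intro mult_left_mono) auto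
    finally show ?thesis .
  qed
  have "e / 2 * norm h' > 0"
    by (intro mult_pos_pos) (use norm_h' h assms in linarith)+
  then obtain N where N: "\<And>n. N \<le> n \<Longrightarrow>
      norm (shift_L2 (int n) (multiplication \<phi> h') - orth_proj H2 (shift_L2 (int n) (multiplication \<phi> h'))) < e / 2 * norm h'"
    using LIMSEQ_D[OF shift_asymptotically_analytic[of "multiplication \<phi> h'"], of "e / 2 * norm h'"]
    by auto
  have "norm (defect \<phi> (shift_L2 (int n) (poly_L2 g))) \<le> e * norm (poly_L2 g)" if "N \<le> n" for n
  proof -
    \<comment> \<open>g is already h' shifted by m, so the total shift is n + m, which is still at
      least N.\<close>
    have shift: "shift_L2 (int n) (poly_L2 g) = shift_L2 (int (n + m)) h'"
      by (simp flip: h'(2) add: shift_shift)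
    have "norm (defect \<phi> (shift_L2 (int (n + m)) h')) \<le>
        norm (fst (defect \<phi> (shift_L2 (int (n + m)) h'))) + norm (snd (defect \<phi> (shift_L2 (int (n + m)) h')))"
      by (metis norm_Pair_le prod.collapse)
    also have "norm (fst (defect \<phi> (shift_L2 (int (n + m)) h'))) \<le> e / 2 * norm h'"
      using \<psi>h' by (simp add: defect_def multiplication_shift defect_symbol_Linfinity)
    also have "norm (snd (defect \<phi> (shift_L2 (int (n + m)) h'))) \<le> e / 2 * norm h'"
      using N[of "n + m"] that by (simp add: defect_def multiplication_shift \<phi>)
    finally show ?thesis
      by (simp only: shift norm_g) simp
  qed
  moreover have "g \<noteq> 0"
    using norm_g norm_h' h by (auto simp: poly_L2_eq_0_iff[THEN iffD2])
  ultimately show ?thesis using that by blast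
qed

text \<open>Among k + 1 shifts of one g with disjoint frequencies, some nontrivial combination f
  meets the k linear constraints. By orthogonality no term outweighs f, so the small defects of the
  shifts bound that of f.\<close>

lemma poly_with_small_defect:
  fixes k :: nat
  assumes add: "\<And>i f g. i < k \<Longrightarrow> L i (f + g) = L i f + L i g"
    and scale: "\<And>i c f. i < k \<Longrightarrow> L i (scaleC c f) = c * L i f"
    and e: "e > 0"
  obtains p where "norm (poly_L2 p) = 1" "\<And>i. i < k \<Longrightarrow> L i (poly_L2 p) = 0"
    "norm (defect \<phi> (poly_L2 p)) \<le> e"
proof -
  \<comment> \<open>Scaling by 0 gives \<open>L i 0 = 0\<close> for the empty sum.\<close>
  have L_sum: "L i (\<Sum>j\<in>J. f j) = (\<Sum>j\<in>J. L i (f j))" if "i < k" for i J and f :: "nat \<Rightarrow> L2"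
    using scale[OF that, of 0 0]
    by (induction J rule: infinite_finite_induct) (auto simp: add that)
  \<comment> \<open>The triangle inequality below adds \<open>Suc k\<close> defects, so each gets
    the share e / \<open>Suc k\<close>.\<close>
  obtain g N where g: "g \<noteq> 0"
    "\<And>n. N \<le> n \<Longrightarrow> norm (defect \<phi> (shift_L2 (int n) (poly_L2 g))) \<le> e / real (Suc k) * norm (poly_L2 g)"
    using defect_small_after_shift[of "e / real (Suc k)"] e by auto
  define D where "D = Suc (degree g)"
  define q where "q j = monom 1 (N + j * D) * g" for j
  define u where "u j = poly_L2 (q j)" for j
  have u_shift: "u j = shift_L2 (int (N + j * D)) (poly_L2 g)" for j
    by (simp only: u_def q_def poly_L2_monom_mult)
  have orth: "cinner (u i) (u j) = 0" if "i \<noteq> j" for i j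
  proof -
    \<comment> \<open>The supports \<open>[N + j D, N + j D + degree g]\<close> of the coefficients are disjoint.\<close>
    have supp: "fourier_coeff (u j) n = 0 \<or> (N + j * D \<le> nat n \<and> nat n < N + j * D + D)" for j n
      by (auto simp: u_def q_def fourier_coeff_poly_L2 coeff_monom_mult D_def
          intro!: coeff_eq_0)
    have disj: "fourier_coeff (u i) n = 0 \<or> fourier_coeff (u j) n = 0" for n
    proof (rule ccontr)
      assume "\<not> ?thesis"
      then have *: "N + i * D \<le> nat n" "nat n < N + i * D + D" "N + j * D \<le> nat n" "nat n < N + j * D + D"
        using supp[of i n] supp[of j n] by auto
      then have "i * D < Suc j * D" "j * D < Suc i * D" by auto
      then show False
        using that by (simp only: mult_less_cancel2) simp
    qed
    have "u j \<in> H2"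
      by (simp add: u_def poly_L2_in_H2)
    from bounded_linear.sums[OF bounded_linear_cinner_right H2_fourier_expansion[OF this]]
    have "(\<lambda>n. cinner (u i) (scaleC (fourier_coeff (u j) (int n)) (monomial_L2 (int n)))) sums cinner (u i) (u j)" .
    moreover have "cinner (u i) (scaleC (fourier_coeff (u j) (int n)) (monomial_L2 (int n))) = 0" for n
      using disj[of "int n"] by (auto simp: cinner_scaleC_right simp flip: fourier_coeff_eq_cinner)
    ultimately show ?thesis
      by (simp add: sums_unique2[OF _ sums_zero])
  qed
  obtain c where c: "\<exists>j<Suc k. c j \<noteq> 0" "\<forall>i<k. (\<Sum>j<Suc k. c j * L i (u j)) = 0"
    using homogeneous_system_nontrivial_solution[of "{..<Suc k}" k "\<lambda>i j. L i (u j)"] by auto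
  define f where "f = (\<Sum>j<Suc k. scaleC (c j) (u j))"
  have norm_f: "(norm f)\<^sup>2 = (\<Sum>j<Suc k. (cmod (c j) * norm (poly_L2 g))\<^sup>2)"
  proof -
    have "(norm f)\<^sup>2 = (\<Sum>j<Suc k. (norm (scaleC (c j) (u j)))\<^sup>2)"
      unfolding f_def
      by (intro norm_sum_orthogonal) (auto simp: cinner_scaleC_left cinner_scaleC_right orth)
    then show ?thesis by (simp only: norm_scaleC u_shift norm_shift)
  qed
  have c_le: "cmod (c j) * norm (poly_L2 g) \<le> norm f" if "j < Suc k" for j
  proof (rule power2_le_imp_le)
    show "(cmod (c j) * norm (poly_L2 g))\<^sup>2 \<le> (norm f)\<^sup>2"
      unfolding norm_f using that by (intro member_le_sum) auto
  qed simp
  have f: "norm f > 0"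
  proof -
    obtain j where "j < Suc k" "c j \<noteq> 0" using c(1) by auto
    then have "0 < cmod (c j) * norm (poly_L2 g)"
      using g(1) by (simp add: poly_L2_eq_0_iff)
    then show ?thesis
      using c_le[OF \<open>j < Suc k\<close>] by linarith
  qed
  have "norm (defect \<phi> f) \<le> (\<Sum>j<Suc k. norm (defect \<phi> (scaleC (c j) (u j))))"
    unfolding f_def linear_sum[OF bounded_linear.linear[OF bounded_linear_defect]]
    by (rule norm_sum)
  also have "\<dots> \<le> (\<Sum>j<Suc k. e / real (Suc k) * norm f)"
  proof (rule sum_mono)
    fix j assume j: "j \<in> {..<Suc k}"
    have "norm (defect \<phi> (scaleC (c j) (u j))) \<le> cmod (c j) * (e / real (Suc k) * norm (poly_L2 g))"
      unfolding norm_defect_scaleC u_shift by (intro mult_left_mono g(2)) auto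
    also have "\<dots> = e / real (Suc k) * (cmod (c j) * norm (poly_L2 g))"
      by simp
    also have "\<dots> \<le> e / real (Suc k) * norm f"
      using c_le[of j] j e by (intro mult_left_mono) auto
    finally show "norm (defect \<phi> (scaleC (c j) (u j))) \<le> e / real (Suc k) * norm f" .
  qed
  also have "\<dots> = e * norm f"
    by simp
  finally have defect_f: "norm (defect \<phi> f) \<le> e * norm f" .
  define b where "b = complex_of_real (inverse (norm f))"
  define p where "p = smult b (\<Sum>j<Suc k. smult (c j) (q j))"
  have p: "poly_L2 p = scaleC b f"
    by (simp only: p_def poly_L2_smult poly_L2_sum f_def u_def)
  have b: "cmod b = inverse (norm f)"
    by (simp add: b_def norm_inverse)
  show ?thesis
  proof (rule that)
    show "norm (poly_L2 p) = 1"
      using f by (simp add: p norm_scaleC b)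
    show "norm (defect \<phi> (poly_L2 p)) \<le> e"
      using defect_f f by (simp add: p norm_defect_scaleC b field_simps)
    show "L i (poly_L2 p) = 0" if "i < k" for i
      using c(2) that by (simp only: p f_def scale L_sum) simp
  qed
qed

lemma cinner_pair_defect_linear:
  "bounded_linear (\<lambda>f. cinner_pair (defect \<phi> f) y)"
  "cinner_pair (defect \<phi> (scaleC c f)) y = c * cinner_pair (defect \<phi> f) y"
proof -
  show "bounded_linear (\<lambda>f. cinner_pair (defect \<phi> f) y)"
    unfolding cinner_pair_def
    by (intro bounded_linear_add bounded_linear_compose[OF bounded_linear_cinner_left]
        bounded_linear_compose[OF bounded_linear_fst] bounded_linear_compose[OF bounded_linear_snd]
        bounded_linear_defect)
  show "cinner_pair (defect \<phi> (scaleC c f)) y = c * cinner_pair (defect \<phi> f) y"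
    by (simp add: cinner_pair_def defect_scaleC cinner_scaleC_left distrib_left)
qed

text \<open>Both kinds of orthogonality to the polynomials already chosen are finitely many linear
  constraints on the next one.\<close>

lemma defect_orthogonal_sequence:
  obtains p :: "nat \<Rightarrow> complex poly"
  where "\<And>n. norm (poly_L2 (p n)) = 1" "\<And>n. norm (defect \<phi> (poly_L2 (p n))) \<le> inverse (real (Suc n))"
    "\<And>i j. i \<noteq> j \<Longrightarrow> cinner (poly_L2 (p i)) (poly_L2 (p j)) = 0"
    "\<And>i j. i \<noteq> j \<Longrightarrow> cinner_pair (defect \<phi> (poly_L2 (p i))) (defect \<phi> (poly_L2 (p j))) = 0"
proof -
  define P where "P p n r \<longleftrightarrow> norm (poly_L2 r) = 1 \<and> norm (defect \<phi> (poly_L2 r)) \<le> inverse (real (Suc n)) \<and>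
      (\<forall>i<n. cinner (poly_L2 r) (poly_L2 (p i)) = 0 \<and>
             cinner_pair (defect \<phi> (poly_L2 r)) (defect \<phi> (poly_L2 (p i))) = 0)"
    for p :: "nat \<Rightarrow> complex poly" and n r
  \<comment> \<open>\<open>P p n r\<close> refers only to \<open>p i\<close> with i < n, so the
    sequence can be chosen recursively.\<close>
  have "\<exists>p. \<forall>n. P p n (p n)"
  proof (rule dependent_wellorder_choice)
    fix r n and f g :: "nat \<Rightarrow> complex poly"
    assume "\<And>y. y < n \<Longrightarrow> f y = g y"
    then show "P f n r = P g n r" by (simp add: P_def)
  next
    fix n and p :: "nat \<Rightarrow> complex poly"
    \<comment> \<open>The first n constraints concern the vectors, the next n their defects.\<close>
    define L where "L i f = (if i < n then cinner f (poly_L2 (p i))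
        else cinner_pair (defect \<phi> f) (defect \<phi> (poly_L2 (p (i - n)))))" for i f
    have "L i (f + g) = L i f + L i g" for i f g
      by (simp add: L_def cinner_add_left
          linear_add[OF bounded_linear.linear[OF cinner_pair_defect_linear(1)]])
    moreover have "L i (scaleC c f) = c * L i f" for i c f
      by (simp add: L_def cinner_scaleC_left cinner_pair_defect_linear(2))
    ultimately obtain r where r: "norm (poly_L2 r) = 1" "\<And>i. i < n + n \<Longrightarrow> L i (poly_L2 r) = 0"
      "norm (defect \<phi> (poly_L2 r)) \<le> inverse (real (Suc n))"
      using poly_with_small_defect[of "n + n" L "inverse (real (Suc n))"]
      by (metis inverse_positive_iff_positive of_nat_0_less_iff zero_less_Suc)
    have "cinner (poly_L2 r) (poly_L2 (p i)) = 0"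
      "cinner_pair (defect \<phi> (poly_L2 r)) (defect \<phi> (poly_L2 (p i))) = 0" if "i < n" for i
      using r(2)[of i] r(2)[of "n + i"] that by (auto simp: L_def)
    then show "\<exists>r. P p n r"
      using r by (auto simp: P_def)
  qed
  then obtain p where p: "\<And>n. P p n (p n)" by blast
  have "cinner (poly_L2 (p i)) (poly_L2 (p j)) = 0 \<and>
      cinner_pair (defect \<phi> (poly_L2 (p i))) (defect \<phi> (poly_L2 (p j))) = 0" if "i \<noteq> j" for i j
  proof (cases "j < i")
    case True
    then show ?thesis using p[of i] by (simp add: P_def)
  next
    case False
    then have "i < j" using that by simp
    then have "cinner (poly_L2 (p j)) (poly_L2 (p i)) = 0"
      "cinner_pair (defect \<phi> (poly_L2 (p j))) (defect \<phi> (poly_L2 (p i))) = 0"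
      using p[of j] by (auto simp: P_def)
    then show ?thesis
      by (subst cinner_commute, subst cinner_pair_commute) simp
  qed
  then show ?thesis
    using that[of p] p by (auto simp: P_def)
qed

section \<open>A closed subspace on which the norm is not attained\<close>

lemma kernel_closed_csubspace:
  fixes L :: "L2 \<Rightarrow> complex"
  assumes "bounded_linear L" "\<And>c f. L (scaleC c f) = c * L f"
  shows "csubspace {f. L f = 0}" "closed {f. L f = 0}"
proof -
  show "csubspace {f. L f = 0}"
    using assms(2) linear_add[OF bounded_linear.linear[OF assms(1)]]
      linear_0[OF bounded_linear.linear[OF assms(1)]] by (auto simp: csubspace_def)
  show "closed {f. L f = 0}"
    by (intro closed_Collect_eq linear_continuous_on assms continuous_on_const)
qed

lemma AN_imp_polynomial_in_defect_kernel:
  assumes AN: "toeplitz \<phi> \<in> AN_operators H2"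
  obtains p where "p \<noteq> 0" "defect \<phi> (poly_L2 p) = 0"
proof (rule ccontr)
  assume "\<not> thesis"
  with that have inj: "defect \<phi> (poly_L2 p) \<noteq> 0" if "p \<noteq> 0" for p
    using that by blast
  define C where "C = Linfinity_norm \<phi>"
  obtain p where p: "\<And>n. norm (poly_L2 (p n)) = 1"
    "\<And>n. norm (defect \<phi> (poly_L2 (p n))) \<le> inverse (real (Suc n))"
    "\<And>i j. i \<noteq> j \<Longrightarrow> cinner (poly_L2 (p i)) (poly_L2 (p j)) = 0"
    "\<And>i j. i \<noteq> j \<Longrightarrow> cinner_pair (defect \<phi> (poly_L2 (p i))) (defect \<phi> (poly_L2 (p j))) = 0"
    using defect_orthogonal_sequence by blast
  define v where "v n = poly_L2 (p n)" for n
  have v: "norm (v n) = 1" "norm (defect \<phi> (v n)) \<le> inverse (real (Suc n))" for n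
    using p by (auto simp: v_def)
  have defect_v: "defect \<phi> (v n) \<noteq> 0" for n
  proof -
    have "p n \<noteq> 0"
      using p(1)[of n] poly_L2_eq_0_iff[of "p n"] by auto
    then show ?thesis by (simp add: v_def inj)
  qed
  \<comment> \<open>The closed linear span, as an intersection: every closed subspace that contains
    all \<open>v n\<close> contains M.\<close>
  define M where "M = \<Inter>{N. csubspace N \<and> closed N \<and> range v \<subseteq> N}"
  have M_least: "M \<subseteq> N" if "csubspace N" "closed N" "range v \<subseteq> N" for N
    using that by (auto simp: M_def)
  have v_M: "v n \<in> M" for n
    by (auto simp: M_def)
  have "csubspace M" "closed M"
    by (auto simp: M_def csubspace_def)
  moreover have M_H2: "M \<subseteq> H2"
    by (intro M_least csubspace_H2 closed_H2) (auto simp: v_def poly_L2_in_H2)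
  moreover have "M \<noteq> {0}"
    using v_M[of 0] v(1)[of 0] by auto
  ultimately have "norm_attaining_on M (toeplitz \<phi>)"
    using AN by (auto simp: AN_operators_def)
  then obtain x where x: "x \<in> M" "norm x = 1" "norm (toeplitz \<phi> x) = onorm_on M (toeplitz \<phi>)"
    by (auto simp: norm_attaining_on_def)
  have C: "0 \<le> C"
    using Linfinity_norm(2)[OF \<phi>] by (simp add: C_def)
  have "norm (toeplitz \<phi> y) / norm y \<le> C" for y
    using norm_toeplitz_le[OF \<phi>, of y] C by (cases "y = 0") (auto simp: C_def divide_le_eq)
  then have bdd: "bdd_above ((\<lambda>y. norm (toeplitz \<phi> y) / norm y) ` M)"
    by (intro bdd_aboveI[of _ C]) auto
  \<comment> \<open>By \<open>norm_defect\<close> the vectors \<open>v n\<close> with small defect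
    push the norm of the restriction up to C, so a maximizing x has defect 0.\<close>
  have "C\<^sup>2 - inverse (real (Suc n)) \<le> (norm (toeplitz \<phi> x))\<^sup>2" for n
  proof -
    have "norm (toeplitz \<phi> (v n)) / norm (v n) \<le> onorm_on M (toeplitz \<phi>)"
      unfolding onorm_on_def by (rule cSUP_upper[OF v_M bdd])
    then have "(norm (toeplitz \<phi> (v n)))\<^sup>2 \<le> (norm (toeplitz \<phi> x))\<^sup>2"
      using v(1)[of n] x(3) by (intro power_mono) auto
    moreover have "(norm (defect \<phi> (v n)))\<^sup>2 \<le> (inverse (real (Suc n)))\<^sup>2"
      by (intro power_mono v) auto
    moreover have "(inverse (real (Suc n)))\<^sup>2 \<le> inverse (real (Suc n))"
      using power_decreasing[of 1 2 "inverse (real (Suc n))"] by (simp add: field_simps)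
    ultimately show ?thesis
      unfolding C_def norm_defect v(1) power_one mult_1_right by linarith
  qed
  moreover have "(\<lambda>n. C\<^sup>2 - inverse (real (Suc n))) \<longlonglongrightarrow> C\<^sup>2 - 0"
    by (intro tendsto_intros LIMSEQ_inverse_real_of_nat)
  ultimately have "C\<^sup>2 \<le> (norm (toeplitz \<phi> x))\<^sup>2"
    by (intro LIMSEQ_le_const2) auto
  then have "(norm (defect \<phi> x))\<^sup>2 \<le> 0"
    using norm_defect[of x] x(2) by (simp add: C_def)
  then have defect_x: "defect \<phi> x = 0"
    by simp
  have cinner_x: "cinner x (v i) = 0" for i
  proof -
    define \<mu> where "\<mu> = cinner_pair (defect \<phi> (v i)) (defect \<phi> (v i))"
    have "\<mu> \<noteq> 0"
      using defect_v[of i] by (simp add: \<mu>_def cinner_pair_self)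
    \<comment> \<open>With W for \<open>defect\<close>, the identity \<langle>W f, W (v i)\<rangle>
      = \<mu> \<langle>f, v i\<rangle> holds for every \<open>v j\<close> by the two
      orthogonalities, hence on M. At f = x its left side is 0, and \<mu> is not.\<close>
    define L where "L f = cinner_pair (defect \<phi> f) (defect \<phi> (v i)) - \<mu> * cinner f (v i)" for f
    have "bounded_linear L"
      unfolding L_def[abs_def]
      by (intro bounded_linear_sub cinner_pair_defect_linear bounded_linear_const_mult
          bounded_linear_cinner_left)
    moreover have "L (scaleC c f) = c * L f" for c f
      by (simp add: L_def cinner_pair_defect_linear(2) cinner_scaleC_left right_diff_distrib)
    moreover have "L (v j) = 0" for j
    proof (cases "i = j")
      case True
      then show ?thesis
        using v(1)[of j] by (simp add: L_def \<mu>_def norm_eq_one_iff_cinner)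
    next
      case False
      then show ?thesis
        using p(3,4)[of j i] by (simp add: L_def v_def)
    qed
    ultimately have "M \<subseteq> {f. L f = 0}"
      by (intro M_least kernel_closed_csubspace) auto
    then have "L x = 0"
      using x(1) by auto
    then show ?thesis
      using defect_x \<open>\<mu> \<noteq> 0\<close> by (simp add: L_def cinner_pair_def)
  qed
  \<comment> \<open>Being orthogonal to all \<open>v n\<close>, x is orthogonal to M and so to
    itself.\<close>
  have "M \<subseteq> {f. cinner f x = 0}"
  proof (intro M_least kernel_closed_csubspace bounded_linear_cinner_left)
    show "range v \<subseteq> {f. cinner f x = 0}"
      using cinner_x by (auto simp: cinner_commute[of "v _" x])
  qed (simp_all add: cinner_scaleC_left)
  then have "cinner x x = 0"
    using x(1) by auto
  then show False
    using x(2) norm_eq_one_iff_cinner[of x] by simp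
qed

lemma AN_imp_unimodular_rational:
  assumes AN: "toeplitz \<phi> \<in> AN_operators H2"
  shows "AE z in circle. cmod (\<phi> z) = Linfinity_norm \<phi>"
    and "rational_on_circle (L2_class \<phi> - orth_proj H2 (L2_class \<phi>))"
proof -
  obtain p where p: "p \<noteq> 0" "defect \<phi> (poly_L2 p) = 0"
    using AN_imp_polynomial_in_defect_kernel[OF AN] .
  then have "multiplication (defect_symbol \<phi>) (poly_L2 p) = 0"
    "multiplication \<phi> (poly_L2 p) = orth_proj H2 (multiplication \<phi> (poly_L2 p))"
    by (simp_all add: defect_def zero_prod_def)
  then have kernel: "L2_class (\<lambda>z. defect_symbol \<phi> z * poly p z) = L2_class (\<lambda>_. 0)"
    "multiplication \<phi> (poly_L2 p) \<in> H2"
    using orth_proj_in_H2[of "multiplication \<phi> (poly_L2 p)"]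
    by (simp_all add: poly_L2_def multiplication_L2_class defect_symbol_Linfinity
        poly_square_integrable L2_class_zero)
  from kernel(1) have "AE z in circle. defect_symbol \<phi> z * poly p z = 0"
    by (subst (asm) L2_class_eq_iff)
       (auto intro!: mult_square_integrable defect_symbol_Linfinity poly_square_integrable
          zero_square_integrable)
  \<comment> \<open>p is nonzero almost everywhere on the circle, so \<psi> vanishes almost
    everywhere.\<close>
  with AE_poly_nonzero[OF p(1)] cmod_defect_symbol
  show "AE z in circle. cmod (\<phi> z) = Linfinity_norm \<phi>"
  proof eventually_elim
    case (elim z)
    then have "(cmod (\<phi> z))\<^sup>2 = (Linfinity_norm \<phi>)\<^sup>2"
      by simp
    then show ?case
      using Linfinity_norm(2)[OF \<phi>] by simp
  qed
  show "rational_on_circle (L2_class \<phi> - orth_proj H2 (L2_class \<phi>))"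
    using kernel(2) by (intro poly_mult_in_H2_imp_rational[OF \<phi> p(1)])
      (simp add: multiplication_poly_L2 \<phi>)
qed

end

theorem theorem2p4:
  fixes \<phi> :: "complex \<Rightarrow> complex"
  assumes "\<phi> \<in> Linfinity"
  shows "toeplitz \<phi> \<in> AN_operators H2 \<longleftrightarrow>
           (AE z in circle. cmod (\<phi> z) = Linfinity_norm \<phi>) \<and>
           rational_on_circle (L2_class \<phi> - orth_proj H2 (L2_class \<phi>))"
  using AN_imp_unimodular_rational[OF assms] toeplitz_AN_if[OF assms] by blast

end
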